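(* Let $\mathfrak{g}$ be a real nilpotent Lie algebra of dimension $n$, graded over a torsion-free abelian group $A$, i.e. $\mathfrak{g}=\bigoplus_{\alpha\in A}\mathfrak{g}_\alpha$ with $[\mathfrak{g}_\alpha,\mathfrak{g}_\beta]\subset\mathfrak{g}_{\alpha+\beta}$. Suppose there is a weight sequence $w_1,\dots,w_n$ (a sequence in which each weight $\alpha$ appears exactly $\dim\mathfrak{g}_\alpha$ times) satisfying, with $\hat i=n+1-i$: (G1) if $w_i+w_j=w_k$ and $i\neq j$, then $i,j<k$; (G2) if $w_i+w_{\hat i}=w_j$, then $j=n$; (G3) if $w_i+w_{\hat i}=w_n$ and $w_i\neq w_{\hat i}$, then one of $w_i,w_{\hat i}$ has multiplicity at least two; (G4) if $w_i+w_{\hat i}=w_n$ and $w_i=w_{\hat i}$, then either $i=\hat i$ or $w_i$ has multiplicity greater than two; (G5) if $w_i+w_j$ is a weight and $w_{\hat i}+w_{\hat j}$ is a weight, then $w_j=w_{\hat i}$ and $w_i=w_{\hat j}$. Then $\mathfrak{g}$ has a Ricci-flat metric of the form $\sum_{i=1}^n e^i\otimes e^{\hat i}$, where $e_1,\dots,e_n$ is a basis of $\mathfrak{g}$ with $e_i\in\mathfrak{g}_{w_i}$ and $e^1,\dots,e^n$ is the dual basis.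
   Context: A weight of the grading is an $\alpha\in A$ with $\mathfrak{g}_\alpha\neq0$, and its multiplicity is $\dim\mathfrak{g}_\alpha$. A metric on $\mathfrak{g}$ is a nondegenerate symmetric bilinear form of arbitrary signature; its Ricci tensor is that of the associated left-invariant pseudo-Riemannian metric on a connected Lie group with Lie algebra $\mathfrak{g}$, restricted to $\mathfrak{g}$; Ricci-flat means the Ricci tensor vanishes. *)

theory Defs
  imports "HOL-Analysis.Analysis"
begin

text \<open>The Lie algebra is the finite-dimensional real vector space 'g (of class
euclidean_space; the inner product of that class plays no role except to give a
basis for the trace) with bracket br.\<close>

definition lie_algebra :: "('g::euclidean_space \<Rightarrow> 'g \<Rightarrow> 'g) \<Rightarrow> bool" where
  "lie_algebra br \<longleftrightarrow> bilinear br \<and> (\<forall>x. br x x = 0) \<and>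
     (\<forall>x y z. br x (br y z) + br y (br z x) + br z (br x y) = 0)"

fun lower_central :: "('g::euclidean_space \<Rightarrow> 'g \<Rightarrow> 'g) \<Rightarrow> nat \<Rightarrow> 'g set" where
  "lower_central br 0 = UNIV"
| "lower_central br (Suc k) = span {br x y | x y. y \<in> lower_central br k}"

definition nilpotent_lie :: "('g::euclidean_space \<Rightarrow> 'g \<Rightarrow> 'g) \<Rightarrow> bool" where
  "nilpotent_lie br \<longleftrightarrow> lie_algebra br \<and> (\<exists>k. lower_central br k = {0})"

definition nat_mult :: "nat \<Rightarrow> 'a::ab_group_add \<Rightarrow> 'a" where
  "nat_mult m x = ((+) x ^^ m) 0"

definition torsion_free :: "'a::ab_group_add itself \<Rightarrow> bool" where
  "torsion_free _ \<longleftrightarrow> (\<forall>(x::'a) m. m > 0 \<and> nat_mult m x = 0 \<longrightarrow> x = 0)"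

definition grading :: "('g::euclidean_space \<Rightarrow> 'g \<Rightarrow> 'g) \<Rightarrow> ('a::ab_group_add \<Rightarrow> 'g set) \<Rightarrow> bool" where
  "grading br G \<longleftrightarrow>
     (\<forall>\<alpha>. subspace (G \<alpha>)) \<and>
     span (\<Union>\<alpha>. G \<alpha>) = UNIV \<and>
     (\<forall>S f. finite S \<and> (\<forall>\<alpha>\<in>S. f \<alpha> \<in> G \<alpha>) \<and> sum f S = 0 \<longrightarrow> (\<forall>\<alpha>\<in>S. f \<alpha> = 0)) \<and>
     (\<forall>\<alpha> \<beta> x y. x \<in> G \<alpha> \<and> y \<in> G \<beta> \<longrightarrow> br x y \<in> G (\<alpha> + \<beta>))"

definition is_weight :: "('a \<Rightarrow> 'g::euclidean_space set) \<Rightarrow> 'a \<Rightarrow> bool" where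
  "is_weight G \<alpha> \<longleftrightarrow> G \<alpha> \<noteq> {0}"

definition mult :: "('a \<Rightarrow> 'g::euclidean_space set) \<Rightarrow> 'a \<Rightarrow> nat" where
  "mult G \<alpha> = dim (G \<alpha>)"

definition weight_sequence :: "('a \<Rightarrow> 'g::euclidean_space set) \<Rightarrow> nat \<Rightarrow> (nat \<Rightarrow> 'a) \<Rightarrow> bool" where
  "weight_sequence G n w \<longleftrightarrow> (\<forall>\<alpha>. card {i\<in>{1..n}. w i = \<alpha>} = mult G \<alpha>)"

definition hat :: "nat \<Rightarrow> nat \<Rightarrow> nat" where
  "hat n i = n + 1 - i"

definition metric :: "('g::euclidean_space \<Rightarrow> 'g \<Rightarrow> real) \<Rightarrow> bool" where
  "metric B \<longleftrightarrow> bilinear B \<and> (\<forall>x y. B x y = B y x) \<and> (\<forall>x. (\<forall>y. B x y = 0) \<longrightarrow> x = 0)"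

text \<open>Levi-Civita connection of the left-invariant metric (Koszul formula):
  2 B(nabla_x y, z) = B([x,y],z) - B([y,z],x) + B([z,x],y).\<close>
definition levi_civita :: "('g::euclidean_space \<Rightarrow> 'g \<Rightarrow> 'g) \<Rightarrow> ('g \<Rightarrow> 'g \<Rightarrow> real) \<Rightarrow> 'g \<Rightarrow> 'g \<Rightarrow> 'g" where
  "levi_civita br B x y = (THE v. \<forall>z. B v z = (B (br x y) z - B (br y z) x + B (br z x) y) / 2)"

definition curvature :: "('g::euclidean_space \<Rightarrow> 'g \<Rightarrow> 'g) \<Rightarrow> ('g \<Rightarrow> 'g \<Rightarrow> real) \<Rightarrow> 'g \<Rightarrow> 'g \<Rightarrow> 'g \<Rightarrow> 'g" where
  "curvature br B x y z = levi_civita br B x (levi_civita br B y z)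
     - levi_civita br B y (levi_civita br B x z) - levi_civita br B (br x y) z"

text \<open>Ric(y,z) = trace (x \<mapsto> R(x,y)z); the trace is computed in the orthonormal
  basis Basis of the euclidean_space 'g.\<close>
definition ricci :: "('g::euclidean_space \<Rightarrow> 'g \<Rightarrow> 'g) \<Rightarrow> ('g \<Rightarrow> 'g \<Rightarrow> real) \<Rightarrow> 'g \<Rightarrow> 'g \<Rightarrow> real" where
  "ricci br B y z = (\<Sum>b\<in>Basis. inner (curvature br B b y z) b)"

definition ricci_flat :: "('g::euclidean_space \<Rightarrow> 'g \<Rightarrow> 'g) \<Rightarrow> ('g \<Rightarrow> 'g \<Rightarrow> real) \<Rightarrow> bool" where
  "ricci_flat br B \<longleftrightarrow> (\<forall>y z. ricci br B y z = 0)"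

end

theory Submission
  imports Defs
begin

text \<open>In a frame \<open>e\<close> with dual indices \<open>hat i\<close>, condition (G1) makes every \<open>ad z\<close> strictly triangular, so
  all trace terms of the Ricci tensor vanish except
  \<open>1/4 \<Sum>i j. B([e j, e i], z) B([e (hat j), e (hat i)], y)\<close>. By (G5) and (G2) a nonzero summand
  has both brackets in the line \<open>G (w n)\<close>, so Ricci-flatness is the single equation
  \<open>\<Sum>i j. \<omega> (e i) (e j) \<omega> (e (hat i)) (e (hat j)) = 0\<close> for an alternating form \<open>\<omega>\<close>, the
  \<open>w n\<close>-component of the bracket. Either two orthogonal hyperbolic planes can be placed at two
  hat-pairs \<open>{p, hat p}\<close>, \<open>{k, hat k}\<close> of the same weights, and there the frame can be deformed to
  give their contribution any real value; or, by (G3) and (G4), each pair of weights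
  \<open>\<alpha>, w n - \<alpha>\<close> has a basis for which every summand vanishes.\<close>

section \<open>Graded bases\<close>

lemma hat_mem: "i \<in> {1..n} \<Longrightarrow> hat n i \<in> {1..n}"
  by (auto simp: hat_def)

lemma hat_hat: "i \<in> {1..n} \<Longrightarrow> hat n (hat n i) = i"
  by (auto simp: hat_def)

lemma hat_eq_iff: "i \<in> {1..n} \<Longrightarrow> j \<in> {1..n} \<Longrightarrow> hat n i = hat n j \<longleftrightarrow> i = j"
  by (auto simp: hat_def)

lemma hat_fixed_unique:
  "i \<in> {1..n} \<Longrightarrow> j \<in> {1..n} \<Longrightarrow> hat n i = i \<Longrightarrow> hat n j = j \<Longrightarrow> i = j"
  by (auto simp: hat_def)

lemma bij_betw_hat: "bij_betw (hat n) {1..n} {1..n}"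
  by (rule bij_betwI[where g = "hat n"]) (auto simp: hat_def)

lemma sum_hat: "(\<Sum>i\<in>{1..n}. f (hat n i)) = (\<Sum>i\<in>{1..n}. f i)"
  by (rule sum.reindex_bij_betw[OF bij_betw_hat])

section \<open>Frames of homogeneous vectors\<close>

locale graded_space =
  fixes G :: "'a::ab_group_add \<Rightarrow> 'g::euclidean_space set"
    and n :: nat and w :: "nat \<Rightarrow> 'a"
  assumes subspace_G: "subspace (G \<alpha>)"
    and span_G: "span (\<Union>\<alpha>. G \<alpha>) = UNIV"
    and direct_G: "finite S \<Longrightarrow> (\<And>\<alpha>. \<alpha> \<in> S \<Longrightarrow> f \<alpha> \<in> G \<alpha>) \<Longrightarrow> sum f S = 0
                   \<Longrightarrow> \<alpha> \<in> S \<Longrightarrow> f \<alpha> = 0"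
    and weights: "weight_sequence G n w"
    and dim_n: "DIM('g) = n"
begin

text \<open>Only spanning is asked for: \<open>n\<close> vectors that span a space of dimension
  \<open>n\<close> are distinct and independent, so a change of frame only has to be checked for
  spanning.\<close>

definition gbasis :: "(nat \<Rightarrow> 'g) \<Rightarrow> bool" where
  "gbasis e \<longleftrightarrow> (\<forall>i\<in>{1..n}. e i \<in> G (w i)) \<and> span (e ` {1..n}) = UNIV"

lemma gbasis_mem: "gbasis e \<Longrightarrow> i \<in> {1..n} \<Longrightarrow> e i \<in> G (w i)"
  by (simp add: gbasis_def)

lemma gbasis_span: "gbasis e \<Longrightarrow> span (e ` {1..n}) = UNIV"
  by (simp add: gbasis_def)

lemma gbasis_card: assumes "gbasis e" shows "card (e ` {1..n}) = n"
proof -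
  have "dim (UNIV::'g set) \<le> card (e ` {1..n})"
    using assms by (intro span_card_ge_dim) (auto simp: gbasis_def)
  moreover have "card (e ` {1..n}) \<le> n"
    using card_image_le[of "{1..n}" e] by simp
  ultimately show ?thesis using dim_n by simp
qed

lemma gbasis_inj: "gbasis e \<Longrightarrow> inj_on e {1..n}"
  using gbasis_card by (intro eq_card_imp_inj_on) auto

lemma gbasis_independent: "gbasis e \<Longrightarrow> independent (e ` {1..n})"
  using gbasis_card gbasis_span dim_n
  by (intro card_le_dim_spanning[of _ UNIV]) auto

lemma gbasis_nonzero: "gbasis e \<Longrightarrow> i \<in> {1..n} \<Longrightarrow> e i \<noteq> 0"
  using gbasis_independent dependent_zero by (metis imageI)

lemma card_weight: "card {i\<in>{1..n}. w i = \<alpha>} = mult G \<alpha>"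
  using weights by (simp add: weight_sequence_def)

text \<open>A weight sequence has exactly \<open>dim (G \<alpha>)\<close> positions of weight
  \<open>\<alpha>\<close>, so a basis of \<open>G \<alpha>\<close> can be indexed by them.\<close>

lemma gbasis_exists: "\<exists>e. gbasis e"
proof -
  have "\<exists>f. f ` {i\<in>{1..n}. w i = \<alpha>} \<subseteq> G \<alpha> \<and> G \<alpha> \<subseteq> span (f ` {i\<in>{1..n}. w i = \<alpha>})" for \<alpha>
  proof -
    obtain C where C: "C \<subseteq> G \<alpha>" "independent C" "G \<alpha> \<subseteq> span C" "card C = dim (G \<alpha>)"
      by (rule basis_exists)
    then have "finite C" using independent_imp_finite by blast
    moreover have "card {i\<in>{1..n}. w i = \<alpha>} = card C"
      using card_weight C(4) by (simp add: mult_def)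
    ultimately obtain f where "bij_betw f {i\<in>{1..n}. w i = \<alpha>} C"
      using finite_same_card_bij[of "{i\<in>{1..n}. w i = \<alpha>}" C] by auto
    then have "f ` {i\<in>{1..n}. w i = \<alpha>} = C" by (simp add: bij_betw_def)
    then show ?thesis using C(1,3) by (intro exI[of _ f]) simp
  qed
  then have "\<forall>\<alpha>. \<exists>f. f ` {i\<in>{1..n}. w i = \<alpha>} \<subseteq> G \<alpha> \<and>
      G \<alpha> \<subseteq> span (f ` {i\<in>{1..n}. w i = \<alpha>})" ..
  from choice[OF this] obtain F where
    F: "F \<alpha> ` {i\<in>{1..n}. w i = \<alpha>} \<subseteq> G \<alpha> \<and>
        G \<alpha> \<subseteq> span (F \<alpha> ` {i\<in>{1..n}. w i = \<alpha>})" for \<alpha>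
    by blast
  define e where "e i = F (w i) i" for i
  have "G \<alpha> \<subseteq> span (e ` {1..n})" for \<alpha>
  proof -
    have "F \<alpha> ` {i\<in>{1..n}. w i = \<alpha>} \<subseteq> e ` {1..n}" by (auto simp: e_def)
    then show ?thesis using F[of \<alpha>] span_mono by blast
  qed
  then have "span (\<Union>\<alpha>. G \<alpha>) \<subseteq> span (e ` {1..n})"
    by (intro span_minimal) auto
  moreover have "e i \<in> G (w i)" if "i \<in> {1..n}" for i
    using F[of "w i"] that by (auto simp: e_def)
  ultimately have "gbasis e" using span_G by (auto simp: gbasis_def)
  then show ?thesis by blast
qed

lemma gbasis_coeffs:
  assumes e: "gbasis e" and v: "v \<in> G \<beta>"
  obtains c where "v = (\<Sum>i | i \<in> {1..n} \<and> w i = \<beta>. c i *\<^sub>R e i)"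
proof -
  have "v \<in> range (\<lambda>u. \<Sum>x\<in>e ` {1..n}. u x *\<^sub>R x)"
    using gbasis_span[OF e] by (simp flip: span_finite)
  then obtain u where "v = (\<Sum>x\<in>e ` {1..n}. u x *\<^sub>R x)" by blast
  then have vsum: "v = (\<Sum>i\<in>{1..n}. u (e i) *\<^sub>R e i)"
    using gbasis_inj[OF e] by (simp add: sum.reindex)
  define S where "S = insert \<beta> (w ` {1..n})"
  define g where "g \<gamma> = (\<Sum>i | i \<in> {1..n} \<and> w i = \<gamma>. u (e i) *\<^sub>R e i)" for \<gamma>
  have "sum g S = v"
    unfolding g_def vsum S_def by (rule sum.group) auto
  \<comment> \<open>Subtracting \<open>v\<close> in degree \<open>\<beta>\<close> leaves a
    homogeneous family with sum zero; directness of the grading then gives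
    \<open>g \<beta> = v\<close>.\<close>
  then have "(\<Sum>\<gamma>\<in>S. g \<gamma> - (if \<gamma> = \<beta> then v else 0)) = 0"
    by (simp add: sum_subtractf S_def)
  moreover have "g \<gamma> - (if \<gamma> = \<beta> then v else 0) \<in> G \<gamma>" for \<gamma>
  proof -
    have "g \<gamma> \<in> G \<gamma>" unfolding g_def
      using gbasis_mem[OF e] subspace_G by (intro subspace_sum subspace_scale) auto
    then show ?thesis using v subspace_G
      by (auto intro!: subspace_diff)
  qed
  ultimately have "g \<beta> - (if \<beta> = \<beta> then v else 0) = 0"
    by (intro direct_G[where S = S and f = "\<lambda>\<gamma>. g \<gamma> - (if \<gamma> = \<beta> then v else 0)"])
      (auto simp: S_def)
  then have "v = (\<Sum>i | i \<in> {1..n} \<and> w i = \<beta>. u (e i) *\<^sub>R e i)"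
    by (simp add: g_def)
  then show ?thesis by (rule that)
qed

lemma weight_index:
  assumes "v \<in> G \<beta>" "v \<noteq> 0" obtains i where "i \<in> {1..n}" "w i = \<beta>"
proof -
  obtain e where "gbasis e" using gbasis_exists ..
  then obtain c where "v = (\<Sum>i | i \<in> {1..n} \<and> w i = \<beta>. c i *\<^sub>R e i)"
    using gbasis_coeffs assms(1) by blast
  then have "{i. i \<in> {1..n} \<and> w i = \<beta>} \<noteq> {}" using assms(2) by (metis sum.empty)
  then show ?thesis using that by blast
qed

text \<open>Steinitz exchange inside one weight space: some frame vector with index outside
  \<open>K\<close> occurs in \<open>v\<close> and can be replaced by it. Vectors already placed at
  \<open>K\<close> and vectors of other weights survive.\<close>

lemma exchange:
  assumes e: "gbasis e" and K: "K \<subseteq> {1..n}" and j: "j \<in> {1..n}" "j \<notin> K"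
    and v: "v \<in> G (w j)" "v \<notin> span (e ` K)"
  shows "\<exists>e'. gbasis e' \<and> e' j = v \<and> (\<forall>i. i \<in> K \<or> w i \<noteq> w j \<longrightarrow> e' i = e i)"
proof -
  let ?X = "{i. i \<in> {1..n} \<and> w i = w j}"
  obtain c where c: "v = (\<Sum>i\<in>?X. c i *\<^sub>R e i)" using gbasis_coeffs[OF e v(1)] .
  have "\<exists>k\<in>?X. k \<notin> K \<and> c k \<noteq> 0"
  proof (rule ccontr)
    assume "\<not> ?thesis"
    then have *: "c i = 0" if "i \<in> ?X" "i \<notin> K" for i using that by blast
    have "v \<in> span (e ` K)" unfolding c
    proof (intro span_sum)
      fix i assume "i \<in> ?X"
      then show "c i *\<^sub>R e i \<in> span (e ` K)"
        using * by (cases "i \<in> K") (auto intro: span_scale span_base span_zero)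
    qed
    then show False using v by simp
  qed
  then obtain k where k: "k \<in> ?X" "k \<notin> K" "c k \<noteq> 0" by blast
  \<comment> \<open>It is \<open>e k\<close> that leaves the frame; \<open>e j\<close> moves to its
    position, which has the same weight. For \<open>k = j\<close> the second update wins.\<close>
  define e' where "e' = (e(k := e j))(j := v)"
  have mem: "e i \<in> span (e' ` {1..n})" if "i \<in> {1..n}" "i \<noteq> k" for i
  proof (cases "i = j")
    case True
    then have "e i = e' k" using that by (auto simp: e'_def)
    then show ?thesis using k by (auto intro: span_base)
  next
    case False
    then have "e i = e' i" using that by (auto simp: e'_def)
    then show ?thesis using that by (auto intro: span_base)
  qed
  have "v = c k *\<^sub>R e k + (\<Sum>i\<in>?X - {k}. c i *\<^sub>R e i)"
    unfolding c using k by (intro sum.remove) auto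
  then have "e k = (1 / c k) *\<^sub>R (v - (\<Sum>i\<in>?X - {k}. c i *\<^sub>R e i))"
    using k(3) by simp
  moreover have "v \<in> span (e' ` {1..n})" using j by (auto simp: e'_def intro: span_base)
  ultimately have "e k \<in> span (e' ` {1..n})"
    using mem by (auto intro!: span_scale span_diff span_sum)
  then have "e ` {1..n} \<subseteq> span (e' ` {1..n})"
    using mem by blast
  then have "span (e ` {1..n}) \<subseteq> span (e' ` {1..n})"
    by (intro span_minimal) auto
  then have "gbasis e'"
    using e j k v unfolding gbasis_def by (auto simp: e'_def)
  then show ?thesis
    using k j by (intro exI[of _ e']) (auto simp: e'_def)
qed

end

section \<open>Alternating forms of degree \<open>w n\<close>\<close>

locale graded_form = graded_space G n w
  for G :: "'a::ab_group_add \<Rightarrow> 'g::euclidean_space set" and n :: nat and w :: "nat \<Rightarrow> 'a" +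
  fixes \<omega> :: "'g \<Rightarrow> 'g \<Rightarrow> real"
  assumes bilinear_\<omega>: "bilinear \<omega>"
    and alternating: "\<omega> x x = 0"
    and degree: "x \<in> G \<alpha> \<Longrightarrow> y \<in> G \<beta> \<Longrightarrow> \<omega> x y \<noteq> 0 \<Longrightarrow> \<alpha> + \<beta> = w n"
begin

lemmas \<omega>_simps = bilinear_ladd[OF bilinear_\<omega>] bilinear_radd[OF bilinear_\<omega>]
  bilinear_lsub[OF bilinear_\<omega>] bilinear_rsub[OF bilinear_\<omega>]
  bilinear_lmul[OF bilinear_\<omega>] bilinear_rmul[OF bilinear_\<omega>]
  bilinear_lzero[OF bilinear_\<omega>] bilinear_rzero[OF bilinear_\<omega>]

lemma skew: "\<omega> x y = - \<omega> y x"
proof -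
  have "\<omega> x y + \<omega> y x = 0"
    using alternating[of "x + y"] alternating[of x] alternating[of y] by (simp add: \<omega>_simps)
  then show ?thesis by linarith
qed

text \<open>The vectors \<open>\<omega>\<close>-orthogonal to \<open>y\<close> form a subspace. This
  serves to check the span condition of \<open>exchange\<close>.\<close>

lemma not_in_span_left:
  assumes "\<And>x. x \<in> S \<Longrightarrow> \<omega> x y = 0" "\<omega> v y \<noteq> 0" shows "v \<notin> span S"
proof
  assume "v \<in> span S"
  then have "\<omega> v y = 0"
    using assms(1) by (induction rule: span_induct) (auto simp: subspace_def \<omega>_simps)
  then show False using assms(2) by simp
qed

text \<open>A Gram-Schmidt step for an alternating form: the other frame vectors lose their
  projections to the plane of \<open>e p\<close> and \<open>e q\<close>. The last two conclusions
  allow a further step with an orthogonal plane without spoiling the first.\<close>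

lemma orthogonalize:
  assumes e: "gbasis e" and p: "p \<in> {1..n}" and q: "q \<in> {1..n}" and pq: "\<omega> (e p) (e q) = 1"
  obtains e' where "gbasis e'"
    "\<And>i. i \<in> {1..n} - {p, q} \<Longrightarrow> \<omega> (e' i) (e p) = 0 \<and> \<omega> (e' i) (e q) = 0"
    "\<And>i. i \<in> {p, q} \<or> (\<omega> (e i) (e p) = 0 \<and> \<omega> (e i) (e q) = 0) \<Longrightarrow> e' i = e i"
    "\<And>i x. \<omega> (e p) x = 0 \<Longrightarrow> \<omega> (e q) x = 0 \<Longrightarrow> \<omega> (e' i) x = \<omega> (e i) x"
proof -
  define e' where "e' i = (if i \<in> {p, q} then e i
      else e i - \<omega> (e i) (e q) *\<^sub>R e p + \<omega> (e i) (e p) *\<^sub>R e q)" for i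
  have qp: "\<omega> (e q) (e p) = -1" using skew[of "e q"] pq by simp
  have wpq: "w p + w q = w n"
    using degree[OF gbasis_mem[OF e p] gbasis_mem[OF e q]] pq by simp
  have "e' i \<in> G (w i)" if i: "i \<in> {1..n}" for i
  proof -
    have *: "c *\<^sub>R e j \<in> G (w i)" if "j \<in> {1..n}" "c \<noteq> 0 \<Longrightarrow> w i = w j" for c j
      using gbasis_mem[OF e that(1)] that(2) subspace_G[of "w i"]
      by (cases "c = 0") (auto simp: subspace_0 subspace_scale)
    \<comment> \<open>A nonzero coefficient forces \<open>w i = w p\<close> or
      \<open>w i = w q\<close> respectively, so each correction has weight
      \<open>w i\<close>.\<close>
    have "\<omega> (e i) (e q) *\<^sub>R e p \<in> G (w i)" "\<omega> (e i) (e p) *\<^sub>R e q \<in> G (w i)"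
      using degree[OF gbasis_mem[OF e i] gbasis_mem[OF e q]]
        degree[OF gbasis_mem[OF e i] gbasis_mem[OF e p]] p q wpq
      by (auto intro!: *) (metis add.commute add_left_cancel)+
    then show ?thesis using gbasis_mem[OF e i] subspace_G[of "w i"]
      by (auto simp: e'_def subspace_add subspace_diff)
  qed
  moreover have "e i \<in> span (e' ` {1..n})" if i: "i \<in> {1..n}" for i
  proof -
    have pq': "e p \<in> span (e' ` {1..n})" "e q \<in> span (e' ` {1..n})"
      using p q span_base[of "e' p" "e' ` {1..n}"] span_base[of "e' q" "e' ` {1..n}"]
      by (simp_all add: e'_def)
    have e'i: "e' i \<in> span (e' ` {1..n})" using i by (auto intro: span_base)
    have eq: "e i = e' i + (if i \<in> {p, q} then 0
        else \<omega> (e i) (e q) *\<^sub>R e p - \<omega> (e i) (e p) *\<^sub>R e q)"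
      by (simp add: e'_def)
    show ?thesis using pq' e'i
      by (subst eq) (auto intro!: span_add span_diff span_scale span_zero)
  qed
  then have "span (e ` {1..n}) \<subseteq> span (e' ` {1..n})"
    by (intro span_minimal) auto
  ultimately have "gbasis e'"
    using gbasis_span[OF e] by (auto simp: gbasis_def)
  then show ?thesis
    by (rule that) (auto simp: e'_def \<omega>_simps pq qp alternating)
qed

text \<open>The obstruction to Ricci-flatness: for the frame metric of the final theorem,
  \<open>ricci br B y z\<close> is \<open>hsum e\<close> times a factor independent of the summation
  indices.\<close>

definition hsum :: "(nat \<Rightarrow> 'g) \<Rightarrow> real" where
  "hsum e = (\<Sum>i\<in>{1..n}. \<Sum>j\<in>{1..n}. \<omega> (e i) (e j) * \<omega> (e (hat n i)) (e (hat n j)))"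

text \<open>Two \<open>\<omega>\<close>-orthogonal hyperbolic planes with bases
  \<open>u1, v1\<close> and \<open>u2, v2\<close>. The weights \<open>\<alpha>\<close> and
  \<open>w n - \<alpha>\<close> may coincide; the last two equations secure orthogonality in that
  case too.\<close>

definition hyperbolic :: "'a \<Rightarrow> 'g \<Rightarrow> 'g \<Rightarrow> 'g \<Rightarrow> 'g \<Rightarrow> bool" where
  "hyperbolic \<alpha> u1 v1 u2 v2 \<longleftrightarrow>
     u1 \<in> G \<alpha> \<and> u2 \<in> G \<alpha> \<and> v1 \<in> G (w n - \<alpha>) \<and> v2 \<in> G (w n - \<alpha>) \<and>
     \<omega> u1 v1 = 1 \<and> \<omega> u2 v2 = 1 \<and> \<omega> u1 v2 = 0 \<and> \<omega> u2 v1 = 0 \<and> \<omega> u1 u2 = 0 \<and> \<omega> v1 v2 = 0"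

text \<open>Four distinct indices carry the two planes, and the rest of the frame is made orthogonal
  to them. The rest contributes a fixed number \<open>R\<close>; changing the frame inside the sum
  of the planes produces \<open>- R\<close>.\<close>

lemma hsum_zero_if_hyperbolic:
  assumes quad: "hyperbolic \<alpha> u1 v1 u2 v2"
    and p: "p \<in> {1..n}" "w p = \<alpha>" "w (hat n p) = w n - \<alpha>" "hat n p \<noteq> p"
    and k: "k \<in> {1..n}" "w k = \<alpha>" "w (hat n k) = w n - \<alpha>" "hat n k \<noteq> k"
    and pk: "k \<noteq> p" "k \<noteq> hat n p"
  obtains e where "gbasis e" "hsum e = 0"
proof -
  define p' k' where "p' = hat n p" and "k' = hat n k"
  have mem: "p' \<in> {1..n}" "k' \<in> {1..n}" and hh: "hat n p' = p" "hat n k' = k"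
    using p(1) k(1) hat_mem hat_hat by (auto simp: p'_def k'_def)
  have dist: "p' \<noteq> p" "k' \<noteq> k" "k \<noteq> p" "k \<noteq> p'" "k' \<noteq> p" "k' \<noteq> p'"
    using p k pk hh by (auto simp: p'_def k'_def)
  have wt: "w p' = w n - \<alpha>" "w k' = w n - \<alpha>"
    using p k by (auto simp: p'_def k'_def)
  note q = quad[unfolded hyperbolic_def]
  have sk: "\<omega> v1 u1 = -1" "\<omega> v2 u2 = -1" "\<omega> v2 u1 = 0" "\<omega> v1 u2 = 0"
      "\<omega> u2 u1 = 0" "\<omega> v2 v1 = 0"
    using q skew[of v1 u1] skew[of v2 u2] skew[of v2 u1] skew[of v1 u2] skew[of u2 u1]
      skew[of v2 v1] by auto
  obtain e0 where e0: "gbasis e0" using gbasis_exists ..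
  \<comment> \<open>The four vectors are placed one by one at \<open>p\<close>, \<open>p'\<close>,
    \<open>k\<close>, \<open>k'\<close>. Each is independent of its predecessors because it pairs
    nontrivially with a vector orthogonal to all of them.\<close>
  have sp: "u1 \<notin> span (e0 ` {})" by (rule not_in_span_left[of _ v1]) (use q in auto)
  have "\<exists>e'. gbasis e' \<and> e' p = u1 \<and> (\<forall>i. i \<in> {} \<or> w i \<noteq> w p \<longrightarrow> e' i = e0 i)"
    by (rule exchange[OF e0 _ p(1) _ _ sp])
      (use p(1,2) k(1,2) q mem dist wt in simp_all)
  then obtain e1 where e1: "gbasis e1" "e1 p = u1"
    by auto
  have sp: "v1 \<notin> span (e1 ` {p})" by (rule not_in_span_left[of _ u1]) (use e1 sk alternating in auto)
  have "\<exists>e'. gbasis e' \<and> e' p' = v1 \<and> (\<forall>i. i \<in> {p} \<or> w i \<noteq> w p' \<longrightarrow> e' i = e1 i)"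
    by (rule exchange[OF e1(1) _ mem(1) _ _ sp])
      (use p(1,2) k(1,2) q mem dist wt in simp_all)
  then obtain e2 where e2: "gbasis e2" "e2 p = u1" "e2 p' = v1"
    using e1(2-) by auto
  have sp: "u2 \<notin> span (e2 ` {p, p'})" by (rule not_in_span_left[of _ v2]) (use e2 q in auto)
  have "\<exists>e'. gbasis e' \<and> e' k = u2 \<and> (\<forall>i. i \<in> {p, p'} \<or> w i \<noteq> w k \<longrightarrow> e' i = e2 i)"
    by (rule exchange[OF e2(1) _ k(1) _ _ sp])
      (use p(1,2) k(1,2) q mem dist wt in simp_all)
  then obtain e3 where e3: "gbasis e3" "e3 p = u1" "e3 p' = v1" "e3 k = u2"
    using e2(2-) by auto
  have sp: "v2 \<notin> span (e3 ` {p, p', k})"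
    by (rule not_in_span_left[of _ u2]) (use e3 q sk alternating in auto)
  have "\<exists>e'. gbasis e' \<and> e' k' = v2 \<and> (\<forall>i. i \<in> {p, p', k} \<or> w i \<noteq> w k' \<longrightarrow> e' i = e3 i)"
    by (rule exchange[OF e3(1) _ mem(2) _ _ sp])
      (use p(1,2) k(1,2) q mem dist wt in simp_all)
  then obtain e4 where e4: "gbasis e4" "e4 p = u1" "e4 p' = v1" "e4 k = u2" "e4 k' = v2"
    using e3(2-) by auto
  \<comment> \<open>Orthogonalization against the first plane, then the second. As the planes are
    orthogonal, \<open>u2\<close> and \<open>v2\<close> stay in place in the first round, and the
    second preserves the orthogonality to \<open>u1\<close> and \<open>v1\<close>.\<close>
  obtain e5 where e5: "gbasis e5" "e5 p = u1" "e5 p' = v1" "e5 k = u2" "e5 k' = v2"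
     "\<And>i. i \<in> {1..n} - {p, p'} \<Longrightarrow> \<omega> (e5 i) u1 = 0 \<and> \<omega> (e5 i) v1 = 0"
  proof -
    have "\<omega> (e4 p) (e4 p') = 1" using e4 q by simp
    from orthogonalize[OF e4(1) p(1) mem(1) this] obtain e' where e':
      "gbasis e'"
      "\<And>i. i \<in> {1..n} - {p, p'} \<Longrightarrow> \<omega> (e' i) (e4 p) = 0 \<and> \<omega> (e' i) (e4 p') = 0"
      "\<And>i. i \<in> {p, p'} \<or> (\<omega> (e4 i) (e4 p) = 0 \<and> \<omega> (e4 i) (e4 p') = 0) \<Longrightarrow> e' i = e4 i"
      by metis
    show ?thesis
      by (rule that[OF e'(1)]) (use e'(2) e'(3)[of p] e'(3)[of p'] e'(3)[of k] e'(3)[of k'] e4 q sk in auto)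
  qed
  obtain f where f: "gbasis f" "f p = u1" "f p' = v1" "f k = u2" "f k' = v2"
     "\<And>i. i \<in> {1..n} - {p, p', k, k'} \<Longrightarrow>
        \<omega> (f i) u1 = 0 \<and> \<omega> (f i) v1 = 0 \<and> \<omega> (f i) u2 = 0 \<and> \<omega> (f i) v2 = 0"
  proof -
    have "\<omega> (e5 k) (e5 k') = 1" using e5 q by simp
    from orthogonalize[OF e5(1) k(1) mem(2) this] obtain e' where e':
      "gbasis e'"
      "\<And>i. i \<in> {1..n} - {k, k'} \<Longrightarrow> \<omega> (e' i) (e5 k) = 0 \<and> \<omega> (e' i) (e5 k') = 0"
      "\<And>i. i \<in> {k, k'} \<or> (\<omega> (e5 i) (e5 k) = 0 \<and> \<omega> (e5 i) (e5 k') = 0) \<Longrightarrow> e' i = e5 i"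
      "\<And>i x. \<omega> (e5 k) x = 0 \<Longrightarrow> \<omega> (e5 k') x = 0 \<Longrightarrow> \<omega> (e' i) x = \<omega> (e5 i) x"
      by metis
    show ?thesis
    proof (rule that[OF e'(1)])
      fix i assume i: "i \<in> {1..n} - {p, p', k, k'}"
      have "\<omega> (e' i) u1 = \<omega> (e5 i) u1" "\<omega> (e' i) v1 = \<omega> (e5 i) v1"
        using e'(4) e5 q sk by auto
      then show "\<omega> (e' i) u1 = 0 \<and> \<omega> (e' i) v1 = 0 \<and> \<omega> (e' i) u2 = 0 \<and> \<omega> (e' i) v2 = 0"
        using e'(2)[of i] e5(4,5) e5(6)[of i] i by auto
    qed (use e'(3)[of p] e'(3)[of p'] e'(3)[of k] e'(3)[of k'] e5 q sk in auto)
  qed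
  define F where "F = {p, p', k, k'}"
  define R where "R = (\<Sum>i\<in>{1..n}-F. \<Sum>j\<in>{1..n}-F.
      \<omega> (f i) (f j) * \<omega> (f (hat n i)) (f (hat n j)))"
  \<comment> \<open>With \<open>M = (\<tau>, 1; \<delta>, 0)\<close> the matrix of \<open>\<omega>\<close> between \<open>(e p, e k)\<close> and \<open>(e p', e k')\<close>, the indices
    in \<open>F\<close> contribute \<open>- 2 tr (M\<^sup>2) = - 2 (\<tau>\<^sup>2 + 2 \<delta>)\<close>; \<open>\<tau>\<close> only has to be large enough for \<open>\<delta> \<noteq> 0\<close>.\<close>
  define \<tau> where "\<tau> = \<bar>R\<bar> + 1"
  define \<delta> where "\<delta> = (R - 2 * \<tau>\<^sup>2) / 4"
  have "\<tau> * 1 \<le> \<tau> * \<tau>" by (rule mult_left_mono) (auto simp: \<tau>_def)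
  then have "R < 2 * \<tau>\<^sup>2" by (simp add: \<tau>_def power2_eq_square)
  then have \<delta>: "\<delta> \<noteq> 0" by (simp add: \<delta>_def)
  define e where "e = f(p' := \<tau> *\<^sub>R v1 + \<delta> *\<^sub>R v2, k' := v1)"
  have ev: "e p = u1" "e p' = \<tau> *\<^sub>R v1 + \<delta> *\<^sub>R v2" "e k = u2" "e k' = v1"
    using f dist by (auto simp: e_def)
  have ef: "e i = f i" if "i \<notin> F" for i using that by (auto simp: e_def F_def)
  have "gbasis e"
  proof -
    have sp: "v1 \<in> span (e ` {1..n})" "e p' \<in> span (e ` {1..n})"
      using ev mem by (auto intro!: span_base) (metis image_eqI atLeastAtMost_iff One_nat_def)+
    have "v2 = (1 / \<delta>) *\<^sub>R (e p' - \<tau> *\<^sub>R v1)" using ev \<delta> by simp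
    then have v2: "v2 \<in> span (e ` {1..n})" using sp by (auto intro!: span_scale span_diff)
    have "f i \<in> span (e ` {1..n})" if "i \<in> {1..n}" for i
    proof (cases "i = p' \<or> i = k'")
      case True then show ?thesis using sp v2 f by auto
    next
      case False
      then have "f i = e i" by (simp add: e_def)
      then show ?thesis using that by (auto intro: span_base)
    qed
    then have "f ` {1..n} \<subseteq> span (e ` {1..n})" by blast
    then have "span (f ` {1..n}) \<subseteq> span (e ` {1..n})" by (intro span_minimal) auto
    moreover have "\<tau> *\<^sub>R v1 + \<delta> *\<^sub>R v2 \<in> G (w n - \<alpha>)"
      using q subspace_G by (intro subspace_add subspace_scale) auto
    ultimately show ?thesis
      using f(1) q wt unfolding gbasis_def by (auto simp: e_def)
  qed
  have ortho: "\<omega> (e i) (e j) = 0" "\<omega> (e j) (e i) = 0" if "i \<in> {1..n} - F" "j \<in> F" for i j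
  proof -
    show "\<omega> (e i) (e j) = 0"
      using f(6)[of i] that ef[of i] by (auto simp: F_def ev \<omega>_simps)
    then show "\<omega> (e j) (e i) = 0" using skew[of "e j" "e i"] by simp
  qed
  define T where "T i j = \<omega> (e i) (e j) * \<omega> (e (hat n i)) (e (hat n j))" for i j
  have split: "sum g {1..n} = sum g F + sum g ({1..n} - F)" for g :: "nat \<Rightarrow> real"
    using sum.subset_diff[of F "{1..n}" g] p(1) k(1) mem by (simp add: F_def)
  \<comment> \<open>\<open>hat\<close> preserves the complement of \<open>F\<close>, where
    \<open>e\<close> and \<open>f\<close> agree; so \<open>R\<close>, defined from \<open>f\<close>,
    is also the contribution of these indices to \<open>hsum e\<close>.\<close>
  have hF: "hat n i \<in> {1..n} - F" if "i \<in> {1..n} - F" for i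
    using that hat_mem[of i n] hat_hat[of i n] p'_def k'_def hh by (auto simp: F_def)
  have "hsum e = (\<Sum>i\<in>F. \<Sum>j\<in>F. T i j) + (\<Sum>i\<in>F. \<Sum>j\<in>{1..n}-F. T i j)
      + ((\<Sum>i\<in>{1..n}-F. \<Sum>j\<in>F. T i j) + (\<Sum>i\<in>{1..n}-F. \<Sum>j\<in>{1..n}-F. T i j))"
    unfolding hsum_def T_def[symmetric] split sum.distrib by (simp only: ac_simps)
  moreover have "(\<Sum>i\<in>F. \<Sum>j\<in>{1..n}-F. T i j) = 0" "(\<Sum>i\<in>{1..n}-F. \<Sum>j\<in>F. T i j) = 0"
    using ortho by (auto intro!: sum.neutral simp: T_def)
  moreover have "(\<Sum>i\<in>{1..n}-F. \<Sum>j\<in>{1..n}-F. T i j) = R"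
    unfolding R_def T_def using ef hF by (intro sum.cong refl) simp
  moreover have "(\<Sum>i\<in>F. \<Sum>j\<in>F. T i j) = - 2 * (\<tau>\<^sup>2 + 2 * \<delta>)"
    using dist q sk
    by (simp add: F_def T_def p'_def[symmetric] k'_def[symmetric] hh ev \<omega>_simps alternating)
      (simp add: algebra_simps power2_eq_square)
  ultimately have "hsum e = 0" by (simp add: \<delta>_def field_simps)
  with \<open>gbasis e\<close> show ?thesis by (rule that)
qed

section \<open>Frames in which every summand vanishes\<close>

text \<open>Without a hyperbolic quadruple, \<open>\<omega>\<close> has rank at most one on \<open>G \<alpha> \<times> G (w n - \<alpha>)\<close>
  (at most two if the two weights coincide).\<close>

lemma degenerate_block:
  assumes no: "\<And>u1 v1 u2 v2. \<not> hyperbolic \<alpha> u1 v1 u2 v2"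
    and u: "u \<in> G \<alpha>" and v: "v \<in> G (w n - \<alpha>)" and uv: "\<omega> u v = 1"
    and x: "x \<in> G \<alpha>" "\<omega> x u = 0" "\<omega> x v = 0" and y: "y \<in> G (w n - \<alpha>)"
  shows "\<omega> x y = 0"
proof (rule ccontr)
  assume xy: "\<omega> x y \<noteq> 0"
  define z where "z = (1 / \<omega> x y) *\<^sub>R y"
  \<comment> \<open>\<open>y\<close> is rescaled and made orthogonal to \<open>u\<close> and
    \<open>v\<close>, completing a forbidden quadruple. The term in \<open>u\<close> is nonzero only
    if both weights coincide, so \<open>z'\<close> stays homogeneous.\<close>
  define z' where "z' = z - \<omega> u z *\<^sub>R v - \<omega> z v *\<^sub>R u"
  have z: "z \<in> G (w n - \<alpha>)" "\<omega> x z = 1"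
    using y xy subspace_G by (auto simp: z_def \<omega>_simps subspace_scale)
  have "\<omega> z v *\<^sub>R u \<in> G (w n - \<alpha>)"
  proof (cases "\<omega> z v = 0")
    case False
    then have "(w n - \<alpha>) + (w n - \<alpha>) = w n" using degree z v by blast
    then have "w n - \<alpha> = \<alpha>" by (simp add: algebra_simps)
    then show ?thesis using u subspace_G by (simp add: subspace_scale)
  qed (use subspace_G in \<open>simp add: subspace_0\<close>)
  then have "z' \<in> G (w n - \<alpha>)"
    using z v subspace_G unfolding z'_def by (intro subspace_diff) (auto intro: subspace_scale)
  then have "hyperbolic \<alpha> u v x z'"
    using u v x z uv skew[of u x] skew[of v u] skew[of v z]
    by (simp add: hyperbolic_def z'_def \<omega>_simps alternating)
  then show False using no by blast
qed

text \<open>These are the index pairs that (G5) leaves for a nonzero summand with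
  \<open>w i = \<alpha>\<close>; if the condition holds for every weight, then
  \<open>hsum e = 0\<close>.\<close>

definition vanishing :: "'a \<Rightarrow> (nat \<Rightarrow> 'g) \<Rightarrow> bool" where
  "vanishing \<alpha> e \<longleftrightarrow> (\<forall>i\<in>{1..n}. \<forall>j\<in>{1..n}.
     w i = \<alpha> \<and> w (hat n i) = w n - \<alpha> \<and> w j = w n - \<alpha> \<and> w (hat n j) = \<alpha> \<longrightarrow>
     \<omega> (e i) (e j) * \<omega> (e (hat n i)) (e (hat n j)) = 0)"

text \<open>Interchanging \<open>i\<close> and \<open>j\<close> changes the sign of both
  factors.\<close>

lemma vanishing_dual: "vanishing \<alpha> e \<Longrightarrow> vanishing (w n - \<alpha>) e"
  unfolding vanishing_def
proof (intro ballI impI)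
  fix i j
  assume *: "\<forall>i\<in>{1..n}. \<forall>j\<in>{1..n}.
     w i = \<alpha> \<and> w (hat n i) = w n - \<alpha> \<and> w j = w n - \<alpha> \<and> w (hat n j) = \<alpha> \<longrightarrow>
     \<omega> (e i) (e j) * \<omega> (e (hat n i)) (e (hat n j)) = 0"
    and "i \<in> {1..n}" "j \<in> {1..n}"
    "w i = w n - \<alpha> \<and> w (hat n i) = w n - (w n - \<alpha>) \<and> w j = w n - (w n - \<alpha>) \<and>
     w (hat n j) = w n - \<alpha>"
  then have "\<omega> (e j) (e i) * \<omega> (e (hat n j)) (e (hat n i)) = 0" by simp
  then show "\<omega> (e i) (e j) * \<omega> (e (hat n i)) (e (hat n j)) = 0"
    using skew[of "e i" "e j"] skew[of "e (hat n i)" "e (hat n j)"] by simp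
qed

text \<open>The reflected indices have one of the same two weights, so different blocks can be
  adjusted independently.\<close>

lemma vanishing_cong:
  assumes "vanishing \<alpha> e"
    and "\<And>i. i \<in> {1..n} \<Longrightarrow> w i = \<alpha> \<or> w i = w n - \<alpha> \<Longrightarrow> e' i = e i"
  shows "vanishing \<alpha> e'"
  using assms hat_mem unfolding vanishing_def by metis

lemma another_index:
  assumes "finite S" "card S < mult G \<alpha>"
  obtains i where "i \<in> {1..n}" "w i = \<alpha>" "i \<notin> S"
proof -
  have "\<not> {i\<in>{1..n}. w i = \<alpha>} \<subseteq> S"
    using assms card_mono[of S "{i\<in>{1..n}. w i = \<alpha>}"] card_weight[of \<alpha>] by linarith
  then show ?thesis using that by blast
qed

text \<open>With a single hat-pair available the planes are placed crosswise: \<open>u1\<close> at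
  \<open>p\<close> and \<open>v2\<close> at \<open>hat n p\<close> are orthogonal. An index of
  weight \<open>\<alpha>\<close> fixed by \<open>hat\<close> receives \<open>u2\<close>, which is
  orthogonal to \<open>u1\<close>.\<close>

lemma vanishing_if_hyperbolic:
  assumes e: "gbasis e" and q: "hyperbolic \<alpha> u1 v1 u2 v2"
    and p: "p \<in> {1..n}" "w p = \<alpha>" "w (hat n p) = w n - \<alpha>" "hat n p \<noteq> p"
    and unique: "\<And>k. k \<in> {1..n} \<Longrightarrow> w k = \<alpha> \<Longrightarrow> w (hat n k) = w n - \<alpha> \<Longrightarrow> hat n k \<noteq> k
                   \<Longrightarrow> k = p \<or> k = hat n p"
  obtains e' where "gbasis e'" "\<And>i. w i \<noteq> \<alpha> \<Longrightarrow> w i \<noteq> w n - \<alpha> \<Longrightarrow> e' i = e i"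
    "vanishing \<alpha> e'"
proof -
  define p' where "p' = hat n p"
  have p': "p' \<in> {1..n}" "w p' = w n - \<alpha>" "p' \<noteq> p" "hat n p' = p"
    using p hat_mem hat_hat by (auto simp: p'_def)
  note q = q[unfolded hyperbolic_def]
  have sk: "\<omega> v2 u2 = -1" "\<omega> v2 u1 = 0" "\<omega> u2 u1 = 0"
    using q skew[of v2 u2] skew[of v2 u1] skew[of u2 u1] by auto
  have sp: "u1 \<notin> span (e ` {})" by (rule not_in_span_left[of _ v1]) (use q in auto)
  have "\<exists>e'. gbasis e' \<and> e' p = u1 \<and> (\<forall>i. i \<in> {} \<or> w i \<noteq> w p \<longrightarrow> e' i = e i)"
    by (rule exchange[OF e _ p(1) _ _ sp]) (use p q in simp_all)
  then obtain e1 where e1: "gbasis e1" "e1 p = u1" "\<forall>i. w i \<noteq> \<alpha> \<longrightarrow> e1 i = e i"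
    using p by auto
  have sp: "v2 \<notin> span (e1 ` {p})" by (rule not_in_span_left[of _ u2]) (use e1(2) q sk in auto)
  have "\<exists>e'. gbasis e' \<and> e' p' = v2 \<and> (\<forall>i. i \<in> {p} \<or> w i \<noteq> w p' \<longrightarrow> e' i = e1 i)"
    by (rule exchange[OF e1(1) _ p'(1) _ _ sp]) (use p p' q in simp_all)
  then obtain e2 where e2: "gbasis e2" "e2 p = u1" "e2 p' = v2"
      "\<forall>i. w i \<noteq> \<alpha> \<and> w i \<noteq> w n - \<alpha> \<longrightarrow> e2 i = e i"
    using e1(2,3) p' by auto
  obtain e3 where e3: "gbasis e3" "e3 p = u1" "e3 p' = v2"
      "\<And>i. w i \<noteq> \<alpha> \<Longrightarrow> w i \<noteq> w n - \<alpha> \<Longrightarrow> e3 i = e i"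
      "\<And>f. f \<in> {1..n} \<Longrightarrow> hat n f = f \<Longrightarrow> w f = \<alpha> \<Longrightarrow> e3 f = u2"
  proof (cases "\<exists>f\<in>{1..n}. hat n f = f \<and> w f = \<alpha>")
    case False
    then show ?thesis using e2 by (intro that[of e2]) auto
  next
    case True
    then obtain f where f: "f \<in> {1..n}" "hat n f = f" "w f = \<alpha>" by blast
    have fp: "f \<noteq> p" "f \<noteq> p'" using f p p' by auto
    have sp: "u2 \<notin> span (e2 ` {p, p'})"
      by (rule not_in_span_left[of _ v2]) (use e2(2,3) q alternating in auto)
    have "\<exists>e'. gbasis e' \<and> e' f = u2 \<and> (\<forall>i. i \<in> {p, p'} \<or> w i \<noteq> w f \<longrightarrow> e' i = e2 i)"
      by (rule exchange[OF e2(1) _ f(1) _ _ sp]) (use p(1) p'(1) f(3) fp q in simp_all)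
    then obtain e3 where e3: "gbasis e3" "e3 f = u2"
      "\<And>i. i \<in> {p, p'} \<or> w i \<noteq> \<alpha> \<Longrightarrow> e3 i = e2 i" using f(3) by auto
    show ?thesis
    proof (rule that[OF e3(1)])
      fix g assume "g \<in> {1..n}" "hat n g = g" "w g = \<alpha>"
      then have "g = f" using f hat_fixed_unique by blast
      then show "e3 g = u2" using e3 by simp
    qed (use e2 e3(3) in auto)
  qed
  have zero: "\<omega> (e3 i) (e3 j) = 0" if ij: "i = p \<or> j = p"
    "i = p \<or> i = p' \<or> (i \<in> {1..n} \<and> hat n i = i \<and> w i = \<alpha>)"
    "j = p \<or> j = p' \<or> (j \<in> {1..n} \<and> hat n j = j \<and> w j = \<alpha>)" for i j
    using ij e3(2,3,5) q sk alternating by metis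
  have "vanishing \<alpha> e3" unfolding vanishing_def
  proof (intro ballI impI)
    fix i j assume i: "i \<in> {1..n}" and j: "j \<in> {1..n}"
      and wij: "w i = \<alpha> \<and> w (hat n i) = w n - \<alpha> \<and> w j = w n - \<alpha> \<and> w (hat n j) = \<alpha>"
    have i': "i = p \<or> i = p' \<or> hat n i = i" using unique[of i] i wij by (auto simp: p'_def)
    have "hat n j = p \<or> hat n j = p' \<or> hat n (hat n j) = hat n j"
      using unique[of "hat n j"] hat_mem[OF j] hat_hat[OF j] wij by (auto simp: p'_def)
    then have j': "j = p \<or> j = p' \<or> hat n j = j"
      using hat_hat[OF j] p' by (auto simp: p'_def)
    let ?P = "\<lambda>i. i = p \<or> i = p' \<or> (i \<in> {1..n} \<and> hat n i = i \<and> w i = \<alpha>)"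
    have I: "?P i" using i' i wij by blast
    have J: "?P j" using j' j wij by metis
    have H: "?P (hat n i)" "?P (hat n j)" using I J p'(4) p'_def by metis+
    \<comment> \<open>Since \<open>hat\<close> has at most one fixed point, distinct
      \<open>i\<close> and \<open>j\<close> include \<open>p\<close> or \<open>p'\<close>. As
      \<open>hat\<close> exchanges these two, one of the factors involves \<open>e3 p = u1\<close>
      and is zero.\<close>
    consider "i = j" | "i = p \<or> j = p" | "i = p' \<or> j = p'"
      using i' j' hat_fixed_unique[OF i j] by blast
    then show "\<omega> (e3 i) (e3 j) * \<omega> (e3 (hat n i)) (e3 (hat n j)) = 0"
    proof cases
      case 1 then show ?thesis by (simp add: alternating)
    next
      case 2
      then have "\<omega> (e3 i) (e3 j) = 0" using I J by (intro zero)
      then show ?thesis by simp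
    next
      case 3
      have "\<omega> (e3 (hat n i)) (e3 (hat n j)) = 0"
        using 3 H p'(4) by (intro zero) auto
      then show ?thesis by simp
    qed
  qed
  then show ?thesis using e3 that by blast
qed

text \<open>By \<open>degenerate_block\<close>, after orthogonalization \<open>\<omega>\<close>
  lives on a single pair of frame vectors of the block. At indices \<open>k\<close>,
  \<open>l\<close> that are not reflections of each other, this pair cannot make both factors of a
  summand nonzero.\<close>

lemma vanishing_if_degenerate:
  assumes e: "gbasis e" and no: "\<And>u1 v1 u2 v2. \<not> hyperbolic \<alpha> u1 v1 u2 v2"
    and k: "k \<in> {1..n}" "w k = \<alpha>" and l: "l \<in> {1..n}" "w l = w n - \<alpha>"
    and kl: "k \<noteq> l" "hat n k \<noteq> l"
  obtains e' where "gbasis e'" "\<And>i. i \<in> {1..n} \<Longrightarrow> w i \<noteq> \<alpha> \<Longrightarrow> w i \<noteq> w n - \<alpha> \<Longrightarrow> e' i = e i"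
    "vanishing \<alpha> e'"
proof (cases "\<exists>u v. u \<in> G \<alpha> \<and> v \<in> G (w n - \<alpha>) \<and> \<omega> u v \<noteq> 0")
  case False
  then have "vanishing \<alpha> e" using gbasis_mem[OF e] unfolding vanishing_def by fastforce
  then show ?thesis using e that by blast
next
  case True
  then obtain u v' where uv': "u \<in> G \<alpha>" "v' \<in> G (w n - \<alpha>)" "\<omega> u v' \<noteq> 0" by blast
  define v where "v = (1 / \<omega> u v') *\<^sub>R v'"
  have uv: "u \<in> G \<alpha>" "v \<in> G (w n - \<alpha>)" "\<omega> u v = 1"
    using uv' subspace_G by (auto simp: v_def \<omega>_simps subspace_scale)
  have sp: "u \<notin> span (e ` {})" by (rule not_in_span_left[of _ v]) (use uv in auto)
  have "\<exists>e'. gbasis e' \<and> e' k = u \<and> (\<forall>i. i \<in> {} \<or> w i \<noteq> w k \<longrightarrow> e' i = e i)"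
    by (rule exchange[OF e _ k(1) _ _ sp]) (use k uv in simp_all)
  then obtain e1 where e1: "gbasis e1" "e1 k = u" "\<forall>i. w i \<noteq> \<alpha> \<longrightarrow> e1 i = e i"
    using k by auto
  have sp: "v \<notin> span (e1 ` {k})"
    by (rule not_in_span_left[of _ u]) (use e1(2) uv alternating skew[of v u] in auto)
  have "\<exists>e'. gbasis e' \<and> e' l = v \<and> (\<forall>i. i \<in> {k} \<or> w i \<noteq> w l \<longrightarrow> e' i = e1 i)"
    by (rule exchange[OF e1(1) _ l(1) _ _ sp]) (use k l kl uv in simp_all)
  then obtain e2 where e2: "gbasis e2" "e2 k = u" "e2 l = v"
      "\<And>i. w i \<noteq> \<alpha> \<Longrightarrow> w i \<noteq> w n - \<alpha> \<Longrightarrow> e2 i = e i"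
    using e1(2,3) l by auto
  have "\<omega> (e2 k) (e2 l) = 1" using e2 uv by simp
  from orthogonalize[OF e2(1) k(1) l(1) this] obtain f where f: "gbasis f"
    "\<And>i. i \<in> {1..n} - {k, l} \<Longrightarrow> \<omega> (f i) (e2 k) = 0 \<and> \<omega> (f i) (e2 l) = 0"
    "\<And>i. i \<in> {k, l} \<or> (\<omega> (e2 i) (e2 k) = 0 \<and> \<omega> (e2 i) (e2 l) = 0) \<Longrightarrow> f i = e2 i"
    by metis
  have fkl: "f k = u" "f l = v" using f(3) e2 by auto
  have f0: "\<omega> (f i) u = 0" "\<omega> (f i) v = 0" if "i \<in> {1..n}" "i \<notin> {k, l}" for i
    using f(2)[of i] that e2 by auto
  have supp: "i \<in> {k, l} \<and> j \<in> {k, l} \<and> i \<noteq> j"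
    if i: "i \<in> {1..n}" "w i = \<alpha>" and j: "j \<in> {1..n}" "w j = w n - \<alpha>"
      and nz: "\<omega> (f i) (f j) \<noteq> 0" for i j
  proof -
    have ik: "i \<in> {k, l}"
      using degenerate_block[OF no uv, of "f i" "f j"] f0[of i] gbasis_mem[OF f(1)] i j nz
      by metis
    then have "f i = u \<or> f i = v" using fkl by auto
    then have "j \<in> {k, l}" using f0[of j] skew[of "f i" "f j"] j nz by fastforce
    with ik nz show ?thesis using alternating by blast
  qed
  have "vanishing \<alpha> f" unfolding vanishing_def
  proof (intro ballI impI, rule ccontr)
    fix i j assume i: "i \<in> {1..n}" and j: "j \<in> {1..n}"
      and wij: "w i = \<alpha> \<and> w (hat n i) = w n - \<alpha> \<and> w j = w n - \<alpha> \<and> w (hat n j) = \<alpha>"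
      and "\<omega> (f i) (f j) * \<omega> (f (hat n i)) (f (hat n j)) \<noteq> 0"
    then have "\<omega> (f i) (f j) \<noteq> 0" "\<omega> (f (hat n j)) (f (hat n i)) \<noteq> 0"
      using skew[of "f (hat n j)" "f (hat n i)"] by auto
    then have "i \<in> {k, l} \<and> j \<in> {k, l} \<and> i \<noteq> j"
      "hat n i \<in> {k, l} \<and> hat n j \<in> {k, l} \<and> hat n j \<noteq> hat n i"
      using supp i j wij hat_mem by blast+
    \<comment> \<open>\<open>hat\<close> would map \<open>{k, l}\<close> to itself without
      exchanging its elements, hence fix both, but it has at most one fixed point.\<close>
    then show False
      using kl hat_hat[OF k(1)] hat_fixed_unique[OF k(1) l(1)] by auto
  qed
  moreover have "f i = e i" if "i \<in> {1..n}" "w i \<noteq> \<alpha>" "w i \<noteq> w n - \<alpha>" for i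
  proof -
    have "\<omega> (e2 i) (e2 k) = 0" "\<omega> (e2 i) (e2 l) = 0"
      using degree[OF gbasis_mem[OF e2(1) that(1)] gbasis_mem[OF e2(1) k(1)]]
        degree[OF gbasis_mem[OF e2(1) that(1)] gbasis_mem[OF e2(1) l(1)]] that k l
      by (auto simp: algebra_simps)
    then show ?thesis using f(3) e2(4) that by auto
  qed
  ultimately show ?thesis using f(1) that by blast
qed

text \<open>The last hypothesis excludes the situation of \<open>hsum_zero_if_hyperbolic\<close>: if
  a hyperbolic quadruple exists, there is room for only one hat-pair. Without a quadruple, (G3) and
  (G4) provide the extra index for \<open>vanishing_if_degenerate\<close>.\<close>

lemma vanishing_block:
  assumes e: "gbasis e"
    and G3: "\<And>i. i \<in> {1..n} \<Longrightarrow> w i + w (hat n i) = w n \<Longrightarrow> w i \<noteq> w (hat n i) \<Longrightarrow>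
               mult G (w i) \<ge> 2 \<or> mult G (w (hat n i)) \<ge> 2"
    and G4: "\<And>i. i \<in> {1..n} \<Longrightarrow> w i + w (hat n i) = w n \<Longrightarrow> w i = w (hat n i) \<Longrightarrow>
               i = hat n i \<or> mult G (w i) > 2"
    and unused: "\<And>p k u1 v1 u2 v2. p \<in> {1..n} \<Longrightarrow> k \<in> {1..n} \<Longrightarrow> w p = \<alpha> \<Longrightarrow> w k = \<alpha> \<Longrightarrow>
       w (hat n p) = w n - \<alpha> \<Longrightarrow> w (hat n k) = w n - \<alpha> \<Longrightarrow> hat n p \<noteq> p \<Longrightarrow> hat n k \<noteq> k \<Longrightarrow>
       k \<noteq> p \<Longrightarrow> k \<noteq> hat n p \<Longrightarrow> \<not> hyperbolic \<alpha> u1 v1 u2 v2"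
  obtains e' where "gbasis e'" "\<And>i. i \<in> {1..n} \<Longrightarrow> w i \<noteq> \<alpha> \<Longrightarrow> w i \<noteq> w n - \<alpha> \<Longrightarrow> e' i = e i"
    "vanishing \<alpha> e'"
proof (cases "\<exists>p\<in>{1..n}. w p = \<alpha> \<and> w (hat n p) = w n - \<alpha> \<and> hat n p \<noteq> p")
  case False
  have "vanishing \<alpha> e" unfolding vanishing_def
  proof (intro ballI impI)
    fix i j assume i: "i \<in> {1..n}" and j: "j \<in> {1..n}"
      and wij: "w i = \<alpha> \<and> w (hat n i) = w n - \<alpha> \<and> w j = w n - \<alpha> \<and> w (hat n j) = \<alpha>"
    have "hat n i = i" using False i wij by blast
    moreover have "hat n (hat n j) = hat n j"
      using False hat_mem[OF j] hat_hat[OF j] wij by metis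
    ultimately have "i = j" using hat_fixed_unique[OF i j] hat_hat[OF j] by simp
    then show "\<omega> (e i) (e j) * \<omega> (e (hat n i)) (e (hat n j)) = 0" by (simp add: alternating)
  qed
  then show ?thesis using e that by blast
next
  case True
  then obtain p where p: "p \<in> {1..n}" "w p = \<alpha>" "w (hat n p) = w n - \<alpha>" "hat n p \<noteq> p"
    by blast
  then have wp: "w p + w (hat n p) = w n" by simp
  show ?thesis
  proof (cases "\<exists>u1 v1 u2 v2. hyperbolic \<alpha> u1 v1 u2 v2")
    case True
    then obtain u1 v1 u2 v2 where "hyperbolic \<alpha> u1 v1 u2 v2" by blast
    then show ?thesis
      using vanishing_if_hyperbolic[OF e _ p] unused[OF p(1) _ p(2) _ p(3) _ p(4)] that by metis
  next
    case False
    \<comment> \<open>For equal weights the third index from (G4) serves as \<open>l\<close>.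
      Otherwise (G3) yields a second index of one of the weights, to be combined with
      \<open>p\<close> or \<open>hat n p\<close>.\<close>
    obtain k l where "k \<in> {1..n}" "w k = \<alpha>" "l \<in> {1..n}" "w l = w n - \<alpha>"
      "k \<noteq> l" "hat n k \<noteq> l"
    proof (cases "w p = w (hat n p)")
      case True
      then have "2 < mult G \<alpha>" using G4[OF p(1) wp] p by auto
      then have "card {p, hat n p} < mult G \<alpha>" using p(4) by simp
      then obtain l where "l \<in> {1..n}" "w l = \<alpha>" "l \<notin> {p, hat n p}"
        using another_index[of "{p, hat n p}"] by blast
      then show ?thesis using that[of p l] p True by auto
    next
      case False
      then consider "2 \<le> mult G \<alpha>" | "2 \<le> mult G (w n - \<alpha>)"
        using G3[OF p(1) wp] p by auto
      then show ?thesis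
      proof cases
        case 1
        then obtain k where k: "k \<in> {1..n}" "w k = \<alpha>" "k \<notin> {p}"
          using another_index[of "{p}" \<alpha>] by auto
        then show ?thesis
          using that[of k "hat n p"] p False hat_mem[OF p(1)] hat_eq_iff[OF k(1) p(1)] by auto
      next
        case 2
        then obtain l where "l \<in> {1..n}" "w l = w n - \<alpha>" "l \<notin> {hat n p}"
          using another_index[of "{hat n p}" "w n - \<alpha>"] by auto
        then show ?thesis using that[of p l] p False by auto
      qed
    qed
    then show ?thesis using vanishing_if_degenerate[OF e] False that by metis
  qed
qed

section \<open>Assembly over all weights\<close>

lemma hsum_zero_exists:
  assumes G3: "\<And>i. i \<in> {1..n} \<Longrightarrow> w i + w (hat n i) = w n \<Longrightarrow> w i \<noteq> w (hat n i) \<Longrightarrow>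
               mult G (w i) \<ge> 2 \<or> mult G (w (hat n i)) \<ge> 2"
    and G4: "\<And>i. i \<in> {1..n} \<Longrightarrow> w i + w (hat n i) = w n \<Longrightarrow> w i = w (hat n i) \<Longrightarrow>
               i = hat n i \<or> mult G (w i) > 2"
    and G5: "\<And>i j. i \<in> {1..n} \<Longrightarrow> j \<in> {1..n} \<Longrightarrow> w i + w j = w n \<Longrightarrow>
               w (hat n i) + w (hat n j) = w n \<Longrightarrow> w j = w (hat n i) \<and> w i = w (hat n j)"
  obtains e where "gbasis e" "hsum e = 0"
proof (cases "\<exists>\<alpha> p k u1 v1 u2 v2. p \<in> {1..n} \<and> k \<in> {1..n} \<and> w p = \<alpha> \<and> w k = \<alpha> \<and>
       w (hat n p) = w n - \<alpha> \<and> w (hat n k) = w n - \<alpha> \<and> hat n p \<noteq> p \<and> hat n k \<noteq> k \<and>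
       k \<noteq> p \<and> k \<noteq> hat n p \<and> hyperbolic \<alpha> u1 v1 u2 v2")
  case True
  then show ?thesis using hsum_zero_if_hyperbolic that by metis
next
  case False
  \<comment> \<open>The step for \<open>\<alpha>\<close> alters only vectors of weights
    \<open>\<alpha>\<close> and \<open>w n - \<alpha>\<close>, so a weight treated before either
    belongs to the same block or keeps its vectors.\<close>
  have "\<exists>e. gbasis e \<and> (\<forall>\<alpha>\<in>S. vanishing \<alpha> e)" if "finite S" for S
    using that
  proof (induction S)
    case empty
    show ?case using gbasis_exists by simp
  next
    case (insert \<alpha> S)
    then obtain e where e: "gbasis e" "\<forall>\<alpha>\<in>S. vanishing \<alpha> e" by blast
    obtain e' where e': "gbasis e'" "vanishing \<alpha> e'"
      "\<And>i. i \<in> {1..n} \<Longrightarrow> w i \<noteq> \<alpha> \<Longrightarrow> w i \<noteq> w n - \<alpha> \<Longrightarrow> e' i = e i"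
    proof (rule vanishing_block[OF e(1) G3 G4])
    qed (use False in blast)+
    have "vanishing \<beta> e'" if "\<beta> \<in> S" for \<beta>
    proof (cases "\<beta> = \<alpha> \<or> \<beta> = w n - \<alpha>")
      case True
      then show ?thesis using e'(2) vanishing_dual by auto
    next
      case False
      then have "w n - \<beta> \<noteq> \<alpha>" "w n - \<beta> \<noteq> w n - \<alpha>" by (auto simp: algebra_simps)
      then have "e' i = e i" if "i \<in> {1..n}" "w i = \<beta> \<or> w i = w n - \<beta>" for i
        using e'(3)[OF that(1)] that(2) False by metis
      then show ?thesis
        using vanishing_cong[of \<beta> e e'] e(2) that by blast
    qed
    then show ?case using e' by auto
  qed
  then obtain e where e: "gbasis e" "\<forall>\<alpha>\<in>w ` {1..n}. vanishing \<alpha> e" by blast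
  have "\<omega> (e i) (e j) * \<omega> (e (hat n i)) (e (hat n j)) = 0"
    if i: "i \<in> {1..n}" and j: "j \<in> {1..n}" for i j
  proof (rule ccontr)
    assume nz: "\<omega> (e i) (e j) * \<omega> (e (hat n i)) (e (hat n j)) \<noteq> 0"
    have mem: "hat n i \<in> {1..n}" "hat n j \<in> {1..n}" using i j hat_mem by blast+
    have sums: "w i + w j = w n" "w (hat n i) + w (hat n j) = w n"
      using nz degree[OF gbasis_mem[OF e(1) i] gbasis_mem[OF e(1) j]]
        degree[OF gbasis_mem[OF e(1) mem(1)] gbasis_mem[OF e(1) mem(2)]] by auto
    have "w j = w n - w i" using sums(1) by (metis add_diff_cancel_left')
    moreover have "w j = w (hat n i)" "w i = w (hat n j)" using G5[OF i j sums] by blast+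
    moreover have "vanishing (w i) e" using e(2) i by blast
    ultimately show False
      using nz i j unfolding vanishing_def by (elim ballE[where x = i] ballE[where x = j]) simp_all
  qed
  then have "hsum e = 0" unfolding hsum_def by (intro sum.neutral ballI) simp
  then show ?thesis using e(1) that by blast
qed

end

section \<open>The Ricci tensor in a frame\<close>

locale metric_frame =
  fixes br :: "'g::euclidean_space \<Rightarrow> 'g \<Rightarrow> 'g" and B :: "'g \<Rightarrow> 'g \<Rightarrow> real"
    and e :: "nat \<Rightarrow> 'g" and n :: nat
  assumes bilinear_br: "bilinear br" and br_self: "br x x = 0"
    and bilinear_B: "bilinear B" and B_sym: "B x y = B y x"
    and span_e: "span (e ` {1..n}) = UNIV"
    and B_frame: "i \<in> {1..n} \<Longrightarrow> j \<in> {1..n} \<Longrightarrow> B (e i) (e j) = (if j = hat n i then 1 else 0)"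
begin

lemmas br_simps = bilinear_ladd[OF bilinear_br] bilinear_radd[OF bilinear_br]
  bilinear_lmul[OF bilinear_br] bilinear_rmul[OF bilinear_br]

lemmas B_simps = bilinear_ladd[OF bilinear_B] bilinear_radd[OF bilinear_B]
  bilinear_lsub[OF bilinear_B] bilinear_rsub[OF bilinear_B]
  bilinear_lmul[OF bilinear_B] bilinear_rmul[OF bilinear_B]
  bilinear_lneg[OF bilinear_B] bilinear_rneg[OF bilinear_B]
  bilinear_lzero[OF bilinear_B] bilinear_rzero[OF bilinear_B]

lemma linear_B_left: "linear (\<lambda>x. B x y)" and linear_B_right: "linear (B x)"
  using bilinear_B by (auto simp: bilinear_def)

lemma br_skew: "br x y = - br y x"
proof -
  have "br x y + br y x = 0"
    using br_self[of "x + y"] br_self[of x] br_self[of y] by (simp add: br_simps add.commute)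
  then show ?thesis by (rule eq_neg_iff_add_eq_0[THEN iffD2])
qed

lemma B_br_skew: "B (br x y) z = - B (br y x) z"
  by (subst br_skew) (simp add: B_simps)

text \<open>The vectors \<open>e (hat n i)\<close> form the \<open>B\<close>-dual basis of
  \<open>e\<close>; both sides are linear in \<open>x\<close> and agree on the frame.\<close>

lemma expand: "x = (\<Sum>i\<in>{1..n}. B x (e (hat n i)) *\<^sub>R e i)"
proof -
  define f where "f x = (\<Sum>i\<in>{1..n}. B x (e (hat n i)) *\<^sub>R e i)" for x
  have "linear f"
    by (rule linearI)
      (simp_all add: f_def B_simps scaleR_add_left sum.distrib scaleR_sum_right)
  moreover have "y = f y" if y: "y \<in> e ` {1..n}" for y
  proof -
    obtain j where j: "j \<in> {1..n}" "y = e j" using y by blast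
    have "f (e j) = (\<Sum>i\<in>{1..n}. if i = j then e i else 0)"
      unfolding f_def
    proof (intro sum.cong refl)
      fix i assume i: "i \<in> {1..n}"
      show "B (e j) (e (hat n i)) *\<^sub>R e i = (if i = j then e i else 0)"
        using B_frame[OF j(1) hat_mem[OF i]] hat_eq_iff[OF i j(1)] by simp
    qed
    then show ?thesis using j by simp
  qed
  ultimately have "x = f x"
    using linear_eq_on[OF linear_ident, of f x "e ` {1..n}"] span_e by blast
  then show ?thesis by (simp only: f_def)
qed

lemma linear_expand:
  assumes "linear f" shows "f x = (\<Sum>i\<in>{1..n}. B x (e (hat n i)) *\<^sub>R f (e i))"
  by (subst expand[of x]) (simp add: linear_sum[OF assms] linear_scale[OF assms])

lemma B_expand: "B x y = (\<Sum>i\<in>{1..n}. B x (e i) * B y (e (hat n i)))"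
  using linear_expand[OF linear_B_right, of x y] by (simp add: mult.commute)

lemma nondegenerate: "(\<And>z. B x z = B y z) \<Longrightarrow> x = y"
  by (subst expand[of x], subst expand[of y]) simp

text \<open>Independence of the trace from the basis: a double sum over \<open>Basis\<close> and the
  frame is evaluated in either order.\<close>

lemma trace_frame:
  assumes "linear L"
  shows "(\<Sum>b\<in>Basis. L b \<bullet> b) = (\<Sum>i\<in>{1..n}. B (L (e i)) (e (hat n i)))"
proof -
  have "(\<Sum>b\<in>Basis. L b \<bullet> b) = (\<Sum>b\<in>Basis. \<Sum>i\<in>{1..n}. B b (e (hat n i)) * (L (e i) \<bullet> b))"
    by (subst linear_expand[OF assms]) (simp add: inner_sum_left)
  also have "\<dots> = (\<Sum>i\<in>{1..n}. \<Sum>b\<in>Basis. (L (e i) \<bullet> b) * B b (e (hat n i)))"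
    by (subst sum.swap) (simp add: mult.commute)
  also have "\<dots> = (\<Sum>i\<in>{1..n}. B (\<Sum>b\<in>Basis. (L (e i) \<bullet> b) *\<^sub>R b) (e (hat n i)))"
    by (simp add: linear_sum[OF linear_B_left] B_simps)
  finally show ?thesis by (simp add: euclidean_representation)
qed

section \<open>The Levi-Civita connection and its curvature\<close>

abbreviation nabla :: "'g \<Rightarrow> 'g \<Rightarrow> 'g" where "nabla \<equiv> levi_civita br B"

text \<open>\<open>levi_civita\<close> is a definite description, so existence and uniqueness are
  needed: the functional \<open>K\<close> is represented by the vector with coordinates
  \<open>K (e (hat n i))\<close>, unique by nondegeneracy.\<close>

lemma koszul: "B (nabla x y) z = (B (br x y) z - B (br y z) x + B (br z x) y) / 2"
proof -
  define K where "K z = (B (br x y) z - B (br y z) x + B (br z x) y) / 2" for z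
  have "linear K"
    by (rule linearI) (simp_all add: K_def br_simps B_simps algebra_simps add_divide_distrib diff_divide_distrib)
  define v where "v = (\<Sum>i\<in>{1..n}. K (e (hat n i)) *\<^sub>R e i)"
  have v: "B v z = K z" for z
  proof -
    have "B v z = (\<Sum>i\<in>{1..n}. K (e (hat n i)) * B (e i) z)"
      by (simp add: v_def linear_sum[OF linear_B_left] B_simps)
    also have "\<dots> = (\<Sum>i\<in>{1..n}. K (e (hat n (hat n i))) * B (e (hat n i)) z)"
      by (rule sum_hat[symmetric])
    also have "\<dots> = (\<Sum>i\<in>{1..n}. B z (e (hat n i)) *\<^sub>R K (e i))"
      by (intro sum.cong refl) (simp add: hat_hat B_sym)
    also have "\<dots> = K z" by (rule linear_expand[OF \<open>linear K\<close>, symmetric])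
    finally show ?thesis .
  qed
  have "nabla x y = v" unfolding levi_civita_def
  proof (rule the_equality)
    show "\<forall>z. B v z = (B (br x y) z - B (br y z) x + B (br z x) y) / 2"
      using v by (simp add: K_def)
  next
    fix u assume "\<forall>z. B u z = (B (br x y) z - B (br y z) x + B (br z x) y) / 2"
    then have "B u z = B v z" for z using v[of z] unfolding K_def by metis
    then show "u = v" by (rule nondegenerate)
  qed
  then show ?thesis using v by (simp add: K_def)
qed

lemma nabla_metric: "B (nabla x y) z = - B y (nabla x z)"
  unfolding B_sym[of y] koszul
  using B_br_skew[of z x y] B_br_skew[of y x z] B_br_skew[of z y x] by (simp add: field_simps)

lemma nabla_torsion: "nabla x y = nabla y x + br x y"
proof (rule nondegenerate)
  fix z
  show "B (nabla x y) z = B (nabla y x + br x y) z"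
    using B_br_skew[of y x z] B_br_skew[of x z y] B_br_skew[of z y x]
    by (simp add: B_simps koszul field_simps)
qed

lemma bilinear_nabla: "bilinear nabla"
  unfolding bilinear_def
  by (intro conjI allI linearI; rule nondegenerate)
    (simp_all add: koszul B_simps br_simps field_simps)

lemma linear_curvature: "linear (\<lambda>x. curvature br B x y z)"
  unfolding curvature_def
  by (rule linearI)
    (simp_all add: br_simps bilinear_ladd[OF bilinear_nabla] bilinear_radd[OF bilinear_nabla]
      bilinear_lmul[OF bilinear_nabla] bilinear_rmul[OF bilinear_nabla] algebra_simps)

text \<open>The operator \<open>x \<mapsto> nabla x z\<close> splits into the symmetric part of \<open>- ad z\<close> and half the
  skew part given by \<open>J z\<close>; for a frame in which \<open>ad\<close> is triangular, only the latter contributes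
  to the Ricci tensor.\<close>

theorem ricci_triangular:
  assumes tri: "\<And>z i j. i \<in> {1..n} \<Longrightarrow> j \<in> {1..n} \<Longrightarrow> B (br z (e i)) (e j) \<noteq> 0 \<Longrightarrow> i < hat n j"
  shows "ricci br B y z = (\<Sum>i\<in>{1..n}. \<Sum>j\<in>{1..n}.
      B (br (e j) (e i)) z * B (br (e (hat n j)) (e (hat n i))) y) / 4"
proof -
  let ?I = "{1..n}" and ?h = "hat n"
  \<comment> \<open>\<open>T z\<close> is the matrix of \<open>x \<mapsto> nabla x z\<close>. The
    Koszul formula becomes \<open>T = (J - S) / 2\<close>, with \<open>S z\<close> the symmetrized
    matrix of \<open>ad z\<close> and \<open>J z\<close> skew.\<close>
  define D where "D z i j = B (br z (e i)) (e j)" for z i j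
  define J where "J z i j = B (br (e j) (e i)) z" for z i j
  define T where "T z i j = B (nabla (e i) z) (e j)" for z i j
  define S where "S z i j = D z i j + D z j i" for z i j
  have T: "T z i j = (J z i j - S z i j) / 2" for z i j
    using br_skew[of "e i" z] by (simp add: T_def koszul D_def J_def S_def B_simps)
  have S_sym: "S z i j = S z j i" for z i j by (simp add: S_def)
  have J_skew: "J z i j = - J z j i" for z i j
    using br_skew[of "e i" "e j"] by (simp add: J_def B_simps)
  \<comment> \<open>As \<open>hat n j = n + 1 - j\<close>, triangularity confines \<open>D\<close>
    to index sums below \<open>n + 1\<close>, while a trace pairs \<open>i\<close> with
    \<open>hat n i\<close>, at index sum exactly \<open>n + 1\<close>.\<close>
  have D0: "D z i j = 0" if "i \<in> ?I" "j \<in> ?I" "\<not> i + j < n + 1" for z i j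
    using tri[of i j z] that by (cases "D z i j = 0") (auto simp: D_def hat_def)
  have S0: "S z i j = 0" if "i \<in> ?I" "j \<in> ?I" "\<not> i + j < n + 1" for z i j
    using D0[of i j] D0[of j i] that by (simp add: S_def add.commute)
  have S0': "S z i (?h i) = 0" if "i \<in> ?I" for z i
    using S0[OF that hat_mem[OF that]] that by (auto simp: hat_def)
  have trace0: "(\<Sum>i\<in>?I. T v i (?h i)) = 0" for v
  proof -
    have "(\<Sum>i\<in>?I. T v i (?h i)) = (\<Sum>i\<in>?I. J v i (?h i) / 2)"
      by (intro sum.cong refl) (simp add: T S0')
    moreover have "(\<Sum>i\<in>?I. J v (?h i) (?h (?h i)) / 2) = (\<Sum>i\<in>?I. J v i (?h i) / 2)"
      by (rule sum_hat)
    moreover have "(\<Sum>i\<in>?I. J v (?h i) (?h (?h i)) / 2) = - (\<Sum>i\<in>?I. J v i (?h i) / 2)"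
      unfolding sum_negf[symmetric]
    proof (intro sum.cong refl)
      fix i assume "i \<in> ?I"
      then show "J v (?h i) (?h (?h i)) / 2 = - (J v i (?h i) / 2)"
        using J_skew[of v "?h i" i] by (simp add: hat_hat)
    qed
    ultimately show ?thesis by simp
  qed
  \<comment> \<open>Metric compatibility moves \<open>nabla y\<close> to the other argument;
    vanishing torsion splits \<open>nabla y (e (hat n i))\<close> into a \<open>T\<close> and a
    \<open>D\<close> term.\<close>
  have second: "B (nabla y (nabla (e i) z)) (e (?h i)) =
      - (\<Sum>j\<in>?I. T z i j * (T y (?h i) (?h j) + D y (?h i) (?h j)))" for i
  proof -
    have "B (nabla y (nabla (e i) z)) (e (?h i)) = - B (nabla (e i) z) (nabla y (e (?h i)))"
      by (rule nabla_metric)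
    also have "\<dots> = - (\<Sum>j\<in>?I. T z i j * B (nabla y (e (?h i))) (e (?h j)))"
      unfolding T_def by (rule arg_cong[where f = uminus], rule B_expand)
    also have "\<dots> = - (\<Sum>j\<in>?I. T z i j * (T y (?h i) (?h j) + D y (?h i) (?h j)))"
      unfolding nabla_torsion[of y "e (?h i)"] by (simp add: T_def D_def B_simps)
    finally show ?thesis .
  qed
  have third: "(\<Sum>i\<in>?I. B (nabla (br (e i) y) z) (e (?h i))) =
      - (\<Sum>i\<in>?I. \<Sum>j\<in>?I. T z i j * D y (?h j) (?h i))"
  proof -
    have lin: "linear (\<lambda>x. B (nabla x z) (e k))" for k
      by (rule linearI)
        (simp_all add: bilinear_ladd[OF bilinear_nabla] bilinear_lmul[OF bilinear_nabla] B_simps)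
    have "(\<Sum>i\<in>?I. B (nabla (br (e i) y) z) (e (?h i))) =
        (\<Sum>i\<in>?I. \<Sum>j\<in>?I. - (T z j (?h i) * D y i (?h j)))"
      unfolding linear_expand[OF lin, of "br (e _) y"]
      by (simp add: T_def D_def B_br_skew[of "e i" y for i] mult.commute)
    also have "\<dots> = (\<Sum>i\<in>?I. \<Sum>j\<in>?I. - (T z j (?h (?h i)) * D y (?h i) (?h j)))"
      by (rule sum_hat[symmetric])
    also have "\<dots> = (\<Sum>j\<in>?I. \<Sum>i\<in>?I. - (T z j (?h (?h i)) * D y (?h i) (?h j)))"
      by (rule sum.swap)
    also have "\<dots> = (\<Sum>i\<in>?I. \<Sum>j\<in>?I. - (T z i j * D y (?h j) (?h i)))"
      by (intro sum.cong refl) (simp add: hat_hat)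
    finally show ?thesis by (simp add: sum_negf)
  qed
  have "ricci br B y z = (\<Sum>i\<in>?I. B (curvature br B (e i) y z) (e (?h i)))"
    unfolding ricci_def by (rule trace_frame[OF linear_curvature])
  also have "\<dots> = (\<Sum>i\<in>?I. T (nabla y z) i (?h i))
      - (\<Sum>i\<in>?I. B (nabla y (nabla (e i) z)) (e (?h i)))
      - (\<Sum>i\<in>?I. B (nabla (br (e i) y) z) (e (?h i)))"
    by (simp add: curvature_def B_simps T_def sum_subtractf)
  \<comment> \<open>The \<open>D y\<close> terms from \<open>second\<close> and \<open>third\<close>
    are transposes of each other and add up to \<open>S y\<close>.\<close>
  also have "\<dots> = (\<Sum>i\<in>?I. \<Sum>j\<in>?I. T z i j * (T y (?h i) (?h j) + S y (?h i) (?h j)))"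
    unfolding trace0 second third
    by (simp add: sum_negf S_def distrib_left sum.distrib sum_subtractf)
  also have "\<dots> = (\<Sum>i\<in>?I. \<Sum>j\<in>?I. J z i j * J y (?h i) (?h j) / 4
      + (J z i j * S y (?h i) (?h j) / 4 - S z i j * J y (?h i) (?h j) / 4))"
  proof (intro sum.cong refl)
    fix i j assume ij: "i \<in> ?I" "j \<in> ?I"
    \<comment> \<open>The two index sums add up to \<open>2 * n + 2\<close>, so they are not both
      below \<open>n + 1\<close>.\<close>
    have "S z i j = 0 \<or> S y (?h i) (?h j) = 0"
    proof (cases "i + j < n + 1")
      case True
      then have "\<not> ?h i + ?h j < n + 1" using ij by (auto simp: hat_def)
      then show ?thesis using S0[OF hat_mem[OF ij(1)] hat_mem[OF ij(2)]] by blast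
    qed (use S0[OF ij] in blast)
    then show "T z i j * (T y (?h i) (?h j) + S y (?h i) (?h j)) = J z i j * J y (?h i) (?h j) / 4
      + (J z i j * S y (?h i) (?h j) / 4 - S z i j * J y (?h i) (?h j) / 4)"
      by (auto simp: T field_simps)
  qed
  also have "\<dots> = (\<Sum>i\<in>?I. \<Sum>j\<in>?I. J z i j * J y (?h i) (?h j) / 4)"
  proof -
    \<comment> \<open>The mixed terms pair a symmetric with a skew matrix and cancel under the
      exchange of \<open>i\<close> and \<open>j\<close>.\<close>
    define X where "X i j = J z i j * S y (?h i) (?h j) / 4 - S z i j * J y (?h i) (?h j) / 4" for i j
    have X: "X i j = - X j i" for i j
      using J_skew[of z i j] J_skew[of y "?h i" "?h j"] S_sym[of z i j] S_sym[of y "?h i" "?h j"]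
      by (simp add: X_def)
    have "(\<Sum>i\<in>?I. \<Sum>j\<in>?I. X i j) = (\<Sum>i\<in>?I. \<Sum>j\<in>?I. X j i)" by (rule sum.swap)
    also have "\<dots> = - (\<Sum>i\<in>?I. \<Sum>j\<in>?I. X i j)"
      unfolding sum_negf[symmetric] by (intro sum.cong refl) (rule X)
    finally have "(\<Sum>i\<in>?I. \<Sum>j\<in>?I. X i j) = 0" by simp
    then show ?thesis unfolding X_def[symmetric] sum.distrib by simp
  qed
  finally show ?thesis by (simp add: J_def sum_divide_distrib)
qed

end

section \<open>The Ricci-flat metric\<close>

lemma frame_metric_exists:
  fixes e :: "nat \<Rightarrow> 'g::euclidean_space"
  assumes inj: "inj_on e {1..n}" and indep: "independent (e ` {1..n})"
  shows "\<exists>B :: 'g \<Rightarrow> 'g \<Rightarrow> real. bilinear B \<and> (\<forall>x y. B x y = B y x) \<and>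
    (\<forall>i\<in>{1..n}. \<forall>j\<in>{1..n}. B (e i) (e j) = (if j = hat n i then 1 else 0))"
proof -
  have "\<exists>f :: 'g \<Rightarrow> real. linear f \<and> (\<forall>x\<in>e ` {1..n}. f x = (if x = e i then 1 else 0))" for i
    by (rule linear_independent_extend[OF indep])
  then obtain f :: "nat \<Rightarrow> 'g \<Rightarrow> real" where f: "\<And>i. linear (f i)"
    "\<And>i x. x \<in> e ` {1..n} \<Longrightarrow> f i x = (if x = e i then 1 else 0)" by metis
  have fe: "f i (e j) = (if i = j then 1 else 0)" if "i \<in> {1..n}" "j \<in> {1..n}" for i j
    using f(2)[of "e j" i] that inj_on_eq_iff[OF inj that] by auto
  \<comment> \<open>The \<open>f i\<close> are the dual basis, so this is the required sum of tensor
    products; it is symmetric because \<open>hat\<close> is an involution of the indices.\<close>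
  define B where "B x y = (\<Sum>i\<in>{1..n}. f i x * f (hat n i) y)" for x y
  show ?thesis
  proof (intro exI[of _ B] conjI allI ballI)
    show "bilinear B"
      unfolding bilinear_def B_def
      by (intro conjI allI linearI)
        (simp_all add: linear_add[OF f(1)] linear_scale[OF f(1)] algebra_simps
          sum.distrib sum_distrib_left)
    show "B x y = B y x" for x y
    proof -
      have "B x y = (\<Sum>i\<in>{1..n}. f (hat n i) x * f (hat n (hat n i)) y)"
        unfolding B_def by (rule sum_hat[symmetric])
      also have "\<dots> = B y x"
        unfolding B_def by (intro sum.cong refl) (simp add: hat_hat)
      finally show ?thesis .
    qed
    show "B (e i) (e j) = (if j = hat n i then 1 else 0)" if ij: "i \<in> {1..n}" "j \<in> {1..n}" for i j
    proof -
      have "B (e i) (e j) = (\<Sum>k\<in>{1..n}. if k = i then f (hat n k) (e j) else 0)"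
        unfolding B_def using ij by (intro sum.cong refl) (simp add: fe)
      then show ?thesis using ij fe[OF hat_mem[OF ij(1)] ij(2)] by auto
    qed
  qed
qed

theorem theorem1p3:
  fixes br :: "'g::euclidean_space \<Rightarrow> 'g \<Rightarrow> 'g"
    and G :: "'a::ab_group_add \<Rightarrow> 'g set"
    and n :: nat and w :: "nat \<Rightarrow> 'a"
  assumes nil: "nilpotent_lie br"
    and dimn: "DIM('g) = n"
    and tf: "torsion_free TYPE('a)"
    and gr: "grading br G"
    and ws: "weight_sequence G n w"
    and G1: "\<forall>i\<in>{1..n}. \<forall>j\<in>{1..n}. \<forall>k\<in>{1..n}.
               w i + w j = w k \<and> i \<noteq> j \<longrightarrow> i < k \<and> j < k"
    and G2: "\<forall>i\<in>{1..n}. \<forall>j\<in>{1..n}. w i + w (hat n i) = w j \<longrightarrow> j = n"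
    and G3: "\<forall>i\<in>{1..n}. w i + w (hat n i) = w n \<and> w i \<noteq> w (hat n i) \<longrightarrow>
               mult G (w i) \<ge> 2 \<or> mult G (w (hat n i)) \<ge> 2"
    and G4: "\<forall>i\<in>{1..n}. w i + w (hat n i) = w n \<and> w i = w (hat n i) \<longrightarrow>
               i = hat n i \<or> mult G (w i) > 2"
    and G5: "\<forall>i\<in>{1..n}. \<forall>j\<in>{1..n}.
               is_weight G (w i + w j) \<and> is_weight G (w (hat n i) + w (hat n j)) \<longrightarrow>
               w j = w (hat n i) \<and> w i = w (hat n j)"
  shows "\<exists>(e :: nat \<Rightarrow> 'g) (B :: 'g \<Rightarrow> 'g \<Rightarrow> real).
           inj_on e {1..n} \<and> independent (e ` {1..n}) \<and> span (e ` {1..n}) = UNIV \<and>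
           (\<forall>i\<in>{1..n}. e i \<in> G (w i)) \<and>
           bilinear B \<and>
           (\<forall>i\<in>{1..n}. \<forall>j\<in>{1..n}. B (e i) (e j) = (if j = hat n i then 1 else 0)) \<and>
           metric B \<and> ricci_flat br B"
proof -
  have br: "bilinear br" "br x x = 0" for x
    using nil by (auto simp: nilpotent_lie_def lie_algebra_def)
  have br_degree: "br x y \<in> G (\<alpha> + \<beta>)" if "x \<in> G \<alpha>" "y \<in> G \<beta>" for x y \<alpha> \<beta>
    using gr that by (simp add: grading_def)
  have subspaces: "\<forall>\<alpha>. subspace (G \<alpha>)"
    using gr unfolding grading_def by (elim conjE)
  have spans: "span (\<Union>\<alpha>. G \<alpha>) = UNIV"
    using gr unfolding grading_def by (elim conjE)
  have direct: "\<forall>S f. finite S \<and> (\<forall>\<alpha>\<in>S. f \<alpha> \<in> G \<alpha>) \<and> sum f S = 0 \<longrightarrow> (\<forall>\<alpha>\<in>S. f \<alpha> = 0)"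
    using gr unfolding grading_def by (elim conjE)
  interpret graded_space G n w
  proof
    show "f \<alpha> = 0" if "finite S" "\<And>\<alpha>. \<alpha> \<in> S \<Longrightarrow> f \<alpha> \<in> G \<alpha>" "sum f S = 0" "\<alpha> \<in> S" for S f \<alpha>
    proof -
      have "\<forall>\<alpha>\<in>S. f \<alpha> = 0"
        by (rule mp[OF spec[OF spec[OF direct]]]) (intro conjI ballI that)
      then show ?thesis using that(4) by (rule bspec)
    qed
  qed (use subspaces in blast, rule spans, rule ws, rule dimn)
  have n: "n \<in> {1..n}" using dimn DIM_positive[where 'a = 'g] by auto
  obtain e0 where e0: "gbasis e0" using gbasis_exists ..
  \<comment> \<open>\<open>\<phi>\<close> is the coordinate along \<open>e0 n\<close>. It kills
    every weight space except \<open>G (w n)\<close>, so \<open>\<phi> (br x y)\<close> is an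
    alternating form of degree \<open>w n\<close>.\<close>
  obtain \<phi> :: "'g \<Rightarrow> real" where \<phi>: "linear \<phi>"
    "\<And>x. x \<in> e0 ` {1..n} \<Longrightarrow> \<phi> x = (if x = e0 n then 1 else 0)"
    using linear_independent_extend[OF gbasis_independent[OF e0], of "\<lambda>x. if x = e0 n then 1 else 0"]
    by auto
  have \<phi>e0: "\<phi> (e0 i) = (if i = n then 1 else 0)" if "i \<in> {1..n}" for i
    using \<phi>(2)[of "e0 i"] that inj_on_eq_iff[OF gbasis_inj[OF e0] that n] by auto
  have \<phi>0: "\<gamma> = w n" if x: "x \<in> G \<gamma>" "\<phi> x \<noteq> 0" for x \<gamma>
  proof (rule ccontr)
    assume \<gamma>: "\<gamma> \<noteq> w n"
    obtain c where "x = (\<Sum>i | i \<in> {1..n} \<and> w i = \<gamma>. c i *\<^sub>R e0 i)"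
      using gbasis_coeffs[OF e0 x(1)] .
    then have "\<phi> x = (\<Sum>i | i \<in> {1..n} \<and> w i = \<gamma>. c i * \<phi> (e0 i))"
      by (simp add: linear_sum[OF \<phi>(1)] linear_scale[OF \<phi>(1)])
    also have "\<dots> = 0" using \<gamma> by (intro sum.neutral) (auto simp: \<phi>e0)
    finally show False using x by simp
  qed
  interpret graded_form G n w "\<lambda>x y. \<phi> (br x y)"
  proof
    show "bilinear (\<lambda>x y. \<phi> (br x y))"
      using br(1) linear_compose[OF _ \<phi>(1)] by (auto simp: bilinear_def o_def)
    show "\<phi> (br x x) = 0" for x using br(2) linear_0[OF \<phi>(1)] by simp
    show "\<alpha> + \<beta> = w n" if "x \<in> G \<alpha>" "y \<in> G \<beta>" "\<phi> (br x y) \<noteq> 0" for x y \<alpha> \<beta>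
      by (rule \<phi>0[OF br_degree[OF that(1,2)] that(3)])
  qed
  have is_weight: "is_weight G \<gamma>" if "x \<in> G \<gamma>" "x \<noteq> 0" for x \<gamma>
    using that by (auto simp: is_weight_def)
  have weight_n: "is_weight G (w n)"
    using is_weight gbasis_mem[OF e0 n] gbasis_nonzero[OF e0 n] by blast
  obtain e where e: "gbasis e" "hsum e = 0"
  proof (rule hsum_zero_exists)
    show "mult G (w i) \<ge> 2 \<or> mult G (w (hat n i)) \<ge> 2"
      if "i \<in> {1..n}" "w i + w (hat n i) = w n" "w i \<noteq> w (hat n i)" for i
      using G3 that by blast
    show "i = hat n i \<or> mult G (w i) > 2"
      if "i \<in> {1..n}" "w i + w (hat n i) = w n" "w i = w (hat n i)" for i
      using G4 that by blast
    show "w j = w (hat n i) \<and> w i = w (hat n j)"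
      if "i \<in> {1..n}" "j \<in> {1..n}" "w i + w j = w n" "w (hat n i) + w (hat n j) = w n" for i j
      using bspec[OF bspec[OF G5 that(1)] that(2)] that(3,4) weight_n by simp
  qed
  obtain B :: "'g \<Rightarrow> 'g \<Rightarrow> real" where B: "bilinear B" "\<And>x y. B x y = B y x"
    "\<And>i j. i \<in> {1..n} \<Longrightarrow> j \<in> {1..n} \<Longrightarrow> B (e i) (e j) = (if j = hat n i then 1 else 0)"
    using frame_metric_exists[OF gbasis_inj[OF e(1)] gbasis_independent[OF e(1)]] by blast
  interpret metric_frame br B e n
    by unfold_locales (rule br B gbasis_span[OF e(1)] | assumption)+
  \<comment> \<open>By (G1) the bracket of \<open>e k\<close> and \<open>e i\<close> has components
    only along \<open>e m\<close> with \<open>m > i\<close>, and pairing with \<open>e j\<close>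
    extracts \<open>m = hat n j\<close>. For \<open>k = i\<close>, not covered by (G1), the bracket
    is zero.\<close>
  have tri_frame: "i < hat n j"
    if i: "i \<in> {1..n}" and j: "j \<in> {1..n}" and k: "k \<in> {1..n}"
      and nz: "B (br (e k) (e i)) (e j) \<noteq> 0" for i j k
  proof -
    obtain c where c: "br (e k) (e i) = (\<Sum>m | m \<in> {1..n} \<and> w m = w k + w i. c m *\<^sub>R e m)"
      using gbasis_coeffs[OF e(1) br_degree[OF gbasis_mem[OF e(1) k] gbasis_mem[OF e(1) i]]] .
    have "B (br (e k) (e i)) (e j) = (\<Sum>m | m \<in> {1..n} \<and> w m = w k + w i. c m * B (e m) (e j))"
      by (simp add: c linear_sum[OF linear_B_left] B_simps)
    then have "(\<Sum>m | m \<in> {1..n} \<and> w m = w k + w i. c m * B (e m) (e j)) \<noteq> 0"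
      using nz by simp
    then obtain m where "m \<in> {m. m \<in> {1..n} \<and> w m = w k + w i}" "c m * B (e m) (e j) \<noteq> 0"
      by (rule sum.not_neutral_contains_not_neutral)
    then have m: "m \<in> {1..n}" "w m = w k + w i" "B (e m) (e j) \<noteq> 0" by auto
    have "j = hat n m" using B(3)[OF m(1) j] m(3) by (auto split: if_splits)
    then have "m = hat n j" using hat_hat[OF m(1)] by simp
    moreover have "k \<noteq> i" using nz br(2) by (auto simp: B_simps)
    ultimately show ?thesis using G1 k i m by metis
  qed
  have tri: "i < hat n j"
    if i: "i \<in> {1..n}" and j: "j \<in> {1..n}" and nz: "B (br z (e i)) (e j) \<noteq> 0" for z i j
  proof -
    have "linear (\<lambda>z. B (br z (e i)) (e j))"
      by (rule linearI) (simp_all add: br_simps B_simps)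
    from linear_expand[OF this, of z] nz
    have "(\<Sum>k\<in>{1..n}. B z (e (hat n k)) *\<^sub>R B (br (e k) (e i)) (e j)) \<noteq> 0" by simp
    then obtain k where "k \<in> {1..n}" "B z (e (hat n k)) *\<^sub>R B (br (e k) (e i)) (e j) \<noteq> 0"
      by (rule sum.not_neutral_contains_not_neutral)
    then have "k \<in> {1..n}" "B (br (e k) (e i)) (e j) \<noteq> 0" by auto
    then show ?thesis using tri_frame i j by blast
  qed
  have "ricci br B y z = 0" for y z
  proof -
    \<comment> \<open>The factor that converts \<open>B\<close>-values of multiples of
      \<open>e n\<close> into \<open>\<phi>\<close>-values. If \<open>\<phi> (e n) = 0\<close>,
      division gives \<open>r = 0\<close>; this is consistent, since a summand with two nonzero
      brackets forces \<open>\<phi> (e n) \<noteq> 0\<close>.\<close>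
    define r where "r = B (e n) z * B (e n) y / (\<phi> (e n))\<^sup>2"
    have summand: "B (br (e j) (e i)) z * B (br (e (hat n j)) (e (hat n i))) y =
        r * (\<phi> (br (e j) (e i)) * \<phi> (br (e (hat n j)) (e (hat n i))))"
      if i: "i \<in> {1..n}" and j: "j \<in> {1..n}" for i j
    proof (cases "br (e j) (e i) = 0 \<or> br (e (hat n j)) (e (hat n i)) = 0")
      case True
      then show ?thesis using linear_0[OF \<phi>(1)] by (auto simp: B_simps)
    next
      case False
      note mem = hat_mem[OF i] hat_mem[OF j]
      have deg: "br (e j) (e i) \<in> G (w j + w i)"
        "br (e (hat n j)) (e (hat n i)) \<in> G (w (hat n j) + w (hat n i))"
        using br_degree gbasis_mem[OF e(1)] i j mem by blast+
      \<comment> \<open>Both degrees are weights, so (G5) gives \<open>w i = w (hat n j)\<close>,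
        and (G2) then allows only the index \<open>n\<close> in degree \<open>w j + w i\<close>.
        Hence this degree is \<open>w n\<close>, and \<open>G (w n)\<close> is a line.\<close>
      then have wij: "w i = w (hat n j)" "w j = w (hat n i)"
        using is_weight False G5 i j by blast+
      then have "w j + w i = w j + w (hat n j)" by simp
      then have only_n: "m = n" if "m \<in> {1..n}" "w m = w j + w i" for m
        using G2 j that by metis
      obtain m where m: "m \<in> {1..n}" "w m = w j + w i"
        using weight_index[OF deg(1)] False by blast
      then have "m = n" by (rule only_n)
      then have wn: "w j + w i = w n" "w (hat n j) + w (hat n i) = w n"
        using m(2) wij by (simp_all add: add.commute)
      then have "{m. m \<in> {1..n} \<and> w m = w n} = {n}" using only_n n by auto
      then have line: "\<exists>c. x = c *\<^sub>R f n" if "gbasis f" "x \<in> G (w n)" for f x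
        using gbasis_coeffs[OF that] by (metis sum.insert sum.empty finite.emptyI empty_iff add_0_right)
      obtain a where a: "br (e j) (e i) = a *\<^sub>R e n"
        using line[OF e(1)] deg(1) wn by auto
      obtain b where b: "br (e (hat n j)) (e (hat n i)) = b *\<^sub>R e n"
        using line[OF e(1)] deg(2) wn by auto
      obtain c where c: "e n = c *\<^sub>R e0 n"
        using line[OF e0 gbasis_mem[OF e(1) n]] by blast
      then have "\<phi> (e n) = c" using \<phi>e0[OF n] by (simp add: linear_scale[OF \<phi>(1)])
      moreover have "c \<noteq> 0" using c gbasis_nonzero[OF e(1) n] by auto
      ultimately have "\<phi> (e n) \<noteq> 0" by simp
      then show ?thesis
        by (simp add: a b r_def B_simps linear_scale[OF \<phi>(1)] power2_eq_square)
    qed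
    have "ricci br B y z = (\<Sum>i\<in>{1..n}. \<Sum>j\<in>{1..n}.
        B (br (e j) (e i)) z * B (br (e (hat n j)) (e (hat n i))) y) / 4"
      by (rule ricci_triangular[OF tri])
    also have "\<dots> = (\<Sum>i\<in>{1..n}. \<Sum>j\<in>{1..n}.
        r * (\<phi> (br (e j) (e i)) * \<phi> (br (e (hat n j)) (e (hat n i))))) / 4"
      using summand by (intro arg_cong[where f = "\<lambda>s. s / 4"] sum.cong refl) blast
    also have "\<dots> = (\<Sum>j\<in>{1..n}. \<Sum>i\<in>{1..n}.
        r * (\<phi> (br (e j) (e i)) * \<phi> (br (e (hat n j)) (e (hat n i))))) / 4"
      by (subst sum.swap) (rule refl)
    also have "\<dots> = r * hsum e / 4"
      by (simp add: hsum_def sum_distrib_left)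
    finally show ?thesis using e(2) by simp
  qed
  then have "ricci_flat br B" by (simp add: ricci_flat_def)
  moreover have "metric B"
    unfolding metric_def using B(1,2) nondegenerate[of _ 0] by (simp add: B_simps)
  ultimately show ?thesis
    using e(1) B gbasis_inj gbasis_independent gbasis_span gbasis_mem
    by (intro exI[of _ e] exI[of _ B]) auto
qed

end
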